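(* Let $\star$ be a semistar operation on an integral domain $D$ such that $D$ is a P$\star$MD with finite $\star_f$-character, and let $I$ be a quasi-$\star_f$-ideal of $D$. Then: (1) $I$ is $\star_f$-idempotent if and only if $I^{\star_f}$ is a $\star_f$-product of $\star_f$-idempotent quasi-$\star_f$-prime ideals of $D$, that is, $I^{\star_f}=(P_1\cdots P_n)^{\star_f}$, where the $P_i$ are $\star_f$-idempotent quasi-$\star_f$-primes of $D$. (2) The following statements are equivalent: (a) $I$ is $\star_f$-idempotent and $\star_f$-divisorial. (b) $I$ is a $\star_f$-product of $\star_f$-idempotent quasi-$\star_f$-prime ideals that are not quasi-$\star_f$-maximal. (c) $I$ is a $\star_f$-product of $\star_f$-divisorial $\star_f$-idempotent quasi-$\star_f$-prime ideals. (d) $I$ has a unique representation as a $\star_f$-product of incomparable $\star_f$-divisorial $\star_f$-idempotent quasi-$\star_f$-primes.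
   Context: $D$ is an integral domain with quotient field $K$; $\overline{\boldsymbol F}(D)$ is the set of nonzero $D$-submodules of $K$, and $\boldsymbol f(D)$ the set of nonzero finitely generated $D$-submodules of $K$. A semistar operation on $D$ is a map $\star:\overline{\boldsymbol F}(D)\to\overline{\boldsymbol F}(D)$, $E\mapsto E^\star$, such that for all $0\ne x\in K$ and $E,F\in\overline{\boldsymbol F}(D)$: $(xE)^\star=xE^\star$; $E\subseteq F$ implies $E^\star\subseteq F^\star$; $E\subseteq E^\star$ and $(E^\star)^\star=E^\star$. The associated finite-type semistar operation is $E^{\star_f}=\bigcup\{F^\star\mid F\in\boldsymbol f(D),\,F\subseteq E\}$; one has $D^{\star_f}=D^\star$. A quasi-$\star_f$-ideal is a nonzero ideal $I$ of $D$ with $I=I^{\star_f}\cap D$; a quasi-$\star_f$-prime is a prime quasi-$\star_f$-ideal; a quasi-$\star_f$-maximal ideal is one maximal among proper quasi-$\star_f$-ideals. A nonzero ideal $I$ is $\star_f$-idempotent if $I^{\star_f}=(I^2)^{\star_f}$, and $\star_f$-divisorial if $I^{\star_f}$ is divisorial in $D^\star$, i.e. $I^{\star_f}=(D^\star:(D^\star:I^{\star_f}))$, where $(A:B)=\{u\in K\mid uB\subseteq A\}$. $D$ is a P$\star$MD if $(FF^{-1})^{\star_f}=D^{\star_f}$ for each $F\in\boldsymbol f(D)$, where $F^{-1}=(D:F)$. $D$ has finite $\star_f$-character if each nonzero element of $D$ belongs to only finitely many (possibly zero) quasi-$\star_f$-maximal ideals. "$I$ is a $\star_f$-product of $P_1,\dots,P_n$"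 means $I^{\star_f}=(P_1\cdots P_n)^{\star_f}$ (the empty product being $D$). Incomparable means $P_i\not\subseteq P_j$ for $i\ne j$; uniqueness is up to the order of the factors. *)

theory Defs
  imports "HOL-Computational_Algebra.Polynomial_Factorial" "HOL-Library.Multiset"
begin

text \<open>
  The integral domain \<open>D\<close> is a type of class \<^class>\<open>idom\<close> and its quotient field \<open>K\<close> is the
  type of fractions over it. As usual, \<open>D\<close> is identified with its image in \<open>K\<close>, so that
  ideals of \<open>D\<close>, \<open>D\<close>-submodules of \<open>K\<close> and their intersections with \<open>D\<close> are all sets of
  elements of \<open>K\<close>.
\<close>

global_interpretation frac: module "\<lambda>(d::'d::idom) x. to_fract d * x"
  by standard (simp_all add: algebra_simps)

definition base_ring :: "'d::idom fract set" where
  "base_ring = range to_fract"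

definition submodules :: "'d::idom fract set set" where
  "submodules = {E. frac.subspace E \<and> E \<noteq> {0}}"

definition fg_submodules :: "'d::idom fract set set" where
  "fg_submodules = {E. (\<exists>S. finite S \<and> E = frac.span S) \<and> E \<noteq> {0}}"

definition mod_prod :: "'d::idom fract set \<Rightarrow> 'd fract set \<Rightarrow> 'd fract set" where
  "mod_prod E F = frac.span {x * y | x y. x \<in> E \<and> y \<in> F}"

definition mod_prod_list :: "'d::idom fract set list \<Rightarrow> 'd fract set" where
  "mod_prod_list Es = foldr mod_prod Es base_ring"

text \<open>The residual \<open>(A : B)\<close>, taken in \<open>K\<close>.\<close>

definition colon :: "'d::idom fract set \<Rightarrow> 'd fract set \<Rightarrow> 'd fract set" where
  "colon A B = {u. \<forall>x\<in>B. u * x \<in> A}"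

text \<open>
  A semistar operation is a map on the nonzero submodules; here it is a total function on sets
  whose values elsewhere are unconstrained and irrelevant.
\<close>

definition semistar :: "('d::idom fract set \<Rightarrow> 'd fract set) \<Rightarrow> bool" where
  "semistar st \<longleftrightarrow>
     (\<forall>E\<in>submodules. st E \<in> submodules) \<and>
     (\<forall>x E. x \<noteq> 0 \<longrightarrow> E \<in> submodules \<longrightarrow> st ((*) x ` E) = (*) x ` st E) \<and>
     (\<forall>E\<in>submodules. \<forall>F\<in>submodules. E \<subseteq> F \<longrightarrow> st E \<subseteq> st F) \<and>
     (\<forall>E\<in>submodules. E \<subseteq> st E \<and> st (st E) = st E)"

definition finite_type ::
    "('d::idom fract set \<Rightarrow> 'd fract set) \<Rightarrow> 'd fract set \<Rightarrow> 'd fract set" where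
  "finite_type st E = \<Union> {st F | F. F \<in> fg_submodules \<and> F \<subseteq> E}"

definition nonzero_ideal :: "'d::idom fract set \<Rightarrow> bool" where
  "nonzero_ideal I \<longleftrightarrow> I \<in> submodules \<and> I \<subseteq> base_ring"

definition prime_ideal :: "'d::idom fract set \<Rightarrow> bool" where
  "prime_ideal P \<longleftrightarrow> frac.subspace P \<and> P \<subset> base_ring \<and>
     (\<forall>a\<in>base_ring. \<forall>b\<in>base_ring. a * b \<in> P \<longrightarrow> a \<in> P \<or> b \<in> P)"

definition quasi_ideal :: "('d::idom fract set \<Rightarrow> 'd fract set) \<Rightarrow> 'd fract set \<Rightarrow> bool" where
  "quasi_ideal st I \<longleftrightarrow> nonzero_ideal I \<and> I = finite_type st I \<inter> base_ring"

definition quasi_prime :: "('d::idom fract set \<Rightarrow> 'd fract set) \<Rightarrow> 'd fract set \<Rightarrow> bool" where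
  "quasi_prime st P \<longleftrightarrow> quasi_ideal st P \<and> prime_ideal P"

definition quasi_maximal :: "('d::idom fract set \<Rightarrow> 'd fract set) \<Rightarrow> 'd fract set \<Rightarrow> bool" where
  "quasi_maximal st M \<longleftrightarrow> quasi_ideal st M \<and> M \<noteq> base_ring \<and>
     (\<forall>J. quasi_ideal st J \<and> J \<noteq> base_ring \<and> M \<subseteq> J \<longrightarrow> J = M)"

definition star_idempotent :: "('d::idom fract set \<Rightarrow> 'd fract set) \<Rightarrow> 'd fract set \<Rightarrow> bool" where
  "star_idempotent st I \<longleftrightarrow> nonzero_ideal I \<and> finite_type st I = finite_type st (mod_prod I I)"

definition star_divisorial :: "('d::idom fract set \<Rightarrow> 'd fract set) \<Rightarrow> 'd fract set \<Rightarrow> bool" where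
  "star_divisorial st I \<longleftrightarrow> nonzero_ideal I \<and>
     finite_type st I = colon (st base_ring) (colon (st base_ring) (finite_type st I))"

text \<open>The Pruefer star-multiplication domains (P\<open>\<star>\<close>MD); \<open>colon base_ring F\<close> is the inverse of \<open>F\<close>.\<close>

definition star_multiplication_domain :: "('d::idom fract set \<Rightarrow> 'd fract set) \<Rightarrow> bool" where
  "star_multiplication_domain st \<longleftrightarrow>
     (\<forall>F\<in>fg_submodules.
        finite_type st (mod_prod F (colon base_ring F)) = finite_type st base_ring)"

definition finite_star_character :: "('d::idom fract set \<Rightarrow> 'd fract set) \<Rightarrow> bool" where
  "finite_star_character st \<longleftrightarrow>
     (\<forall>x\<in>base_ring. x \<noteq> 0 \<longrightarrow> finite {M. quasi_maximal st M \<and> x \<in> M})"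

definition is_star_product ::
    "('d::idom fract set \<Rightarrow> 'd fract set) \<Rightarrow> 'd fract set \<Rightarrow> 'd fract set list \<Rightarrow> bool" where
  "is_star_product st I Ps \<longleftrightarrow> finite_type st I = finite_type st (mod_prod_list Ps)"

definition incomparable :: "'d::idom fract set list \<Rightarrow> bool" where
  "incomparable Ps \<longleftrightarrow>
     (\<forall>i<length Ps. \<forall>j<length Ps. i \<noteq> j \<longrightarrow> \<not> Ps ! i \<subseteq> Ps ! j)"

end

(*
  For a quasi-maximal ideal M the P-star-MD condition makes the localization of D at M a valuation
  ring, and the finite-type closure of E is the intersection of the localizations of E at the
  quasi-maximal ideals. Equality of closures can therefore be checked locally.

  A proper idempotent ideal of a valuation ring is prime. Hence, for an idempotent quasi-ideal I
  contained in M, the component P of I at M (the contraction to D of the localization of I) is a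
  prime ideal, and the component of I at any N containing P is again P. The components of I are
  thus pairwise incomparable, finite in number, and I is their star-product; conversely, since
  primes below a common M form a chain, any incomparable family of primes with star-product I
  consists of the components of I.

  Finally, I is divisorial if and only if no component of I is quasi-maximal, which reduces the
  divisorial case to the factorization into components.
*)
theory Submission
  imports Defs
begin

section \<open>Submodules and localizations\<close>

text \<open>The P-star-MD condition concerns finitely generated modules and closures, whereas the
  later arguments are valuation-theoretic. The bridge is that F F^{-1} is not contained in a
  quasi-maximal M, so a single product ua with a in F and u in F^{-1} is a unit of D_M. The fact
  extracted from it is that an x outside D_M has 1/x in M D_M; the comparisons in the valuation ring
  D_M rest on this.

  Divisoriality is the delicate point, because the dual (R : I), with R =
  \<open>st base_ring\<close>, involves all quasi-maximal ideals at once. The local reason for the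
  criterion is that an idempotent M D_M has dual D_M, so duality cannot see it. To pass from local
  to global an element d of D outside M is needed that satisfies conditions at the other
  quasi-maximal ideals. Finite character leaves finitely many conditions to impose, and a product of
  elements outside the prime M meets them all.\<close>

lemma base_ring_closed [simp, intro]:
  "0 \<in> base_ring" "1 \<in> base_ring"
  "a \<in> base_ring \<Longrightarrow> b \<in> base_ring \<Longrightarrow> a + b \<in> base_ring"
  "a \<in> base_ring \<Longrightarrow> b \<in> base_ring \<Longrightarrow> a * b \<in> base_ring"
  unfolding base_ring_def
  by (auto simp flip: to_fract_add to_fract_mult to_fract_0 to_fract_1)

lemma common_denominator:
  obtains b where "b \<in> base_ring" "b \<noteq> 0" "b * x \<in> base_ring"
proof (cases x)
  case (Fract a b)
  then have "to_fract b * x = to_fract a"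
    by (simp add: to_fract_def eq_fract Zero_fract_def)
  with Fract show ?thesis
    by (intro that[of "to_fract b"]) (auto simp: base_ring_def)
qed

lemma distinct_eq_singleton: "distinct xs \<Longrightarrow> set xs = {x} \<Longrightarrow> xs = [x]"
  by (cases xs; cases "tl xs") auto

lemma subspace_iff:
  "frac.subspace E \<longleftrightarrow>
     0 \<in> E \<and> (\<forall>x\<in>E. \<forall>y\<in>E. x + y \<in> E) \<and> (\<forall>d\<in>base_ring. \<forall>x\<in>E. d * x \<in> E)"
  by (auto simp: frac.subspace_def base_ring_def)

lemma subspaceI:
  assumes "0 \<in> E" "\<And>x y. x \<in> E \<Longrightarrow> y \<in> E \<Longrightarrow> x + y \<in> E"
    and "\<And>d x. d \<in> base_ring \<Longrightarrow> x \<in> E \<Longrightarrow> d * x \<in> E"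
  shows "frac.subspace E"
  using assms by (simp add: subspace_iff)

lemma subspaceD:
  assumes "frac.subspace E"
  shows "0 \<in> E" "x \<in> E \<Longrightarrow> y \<in> E \<Longrightarrow> x + y \<in> E"
    and "d \<in> base_ring \<Longrightarrow> x \<in> E \<Longrightarrow> d * x \<in> E"
  using assms by (simp_all add: subspace_iff)

lemma subspace_base_ring: "frac.subspace base_ring"
  by (simp add: subspace_iff)

lemma base_ring_eq_span: "base_ring = frac.span {1}"
  by (auto simp: frac.span_singleton base_ring_def)

lemma subspace_vimage_mult:
  assumes "frac.subspace E"
  shows "frac.subspace {x. x * y \<in> E}"
  using assms by (auto simp: subspace_iff distrib_right mult.assoc)


lemma span_image_mult: "(*) x ` frac.span S = frac.span ((*) x ` S)"
  for x :: "'d::idom fract"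
proof -
  interpret module_hom "\<lambda>d x. to_fract d * x" "\<lambda>d x. to_fract d * x" "(*) x"
    by unfold_locales (simp_all add: algebra_simps)
  show ?thesis
    by (rule span_image [symmetric])
qed

lemma fg_submodules_subset: "E \<in> fg_submodules \<Longrightarrow> E \<in> submodules"
  by (auto simp: fg_submodules_def submodules_def)

lemma span_in_fg_submodules:
  assumes "finite S" "x \<in> S" "x \<noteq> 0"
  shows "frac.span S \<in> fg_submodules"
  using assms frac.span_base[of x S] by (auto simp: fg_submodules_def)

lemma base_ring_fg: "base_ring \<in> fg_submodules"
  unfolding base_ring_eq_span by (rule span_in_fg_submodules) auto

lemma fg_submodules_image_mult:
  assumes "F \<in> fg_submodules" "x \<noteq> 0"
  shows "(*) x ` F \<in> fg_submodules"
proof -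
  obtain S where S: "finite S" "F = frac.span S" "F \<noteq> {0}"
    using assms by (auto simp: fg_submodules_def)
  moreover have "(*) x ` F \<noteq> {0}"
  proof
    assume "(*) x ` F = {0}"
    then have "y = 0" if "y \<in> F" for y
      using imageI[OF that, of "(*) x"] \<open>x \<noteq> 0\<close> by simp
    with S frac.span_zero[of S] show False
      by auto
  qed
  ultimately show ?thesis
    by (auto simp: fg_submodules_def span_image_mult intro!: exI[of _ "(*) x ` S"])
qed

lemma base_ring_submodule: "base_ring \<in> submodules"
  using subspace_base_ring by (auto simp: submodules_def set_eq_iff intro!: exI[of _ 1])

lemma submodulesD:
  assumes "E \<in> submodules"
  shows "frac.subspace E" "0 \<in> E"
  using assms subspaceD(1)[of E] by (simp_all add: submodules_def)

lemma submodule_has_nonzero: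
  assumes "E \<in> submodules"
  obtains x where "x \<in> E" "x \<noteq> 0"
proof -
  have "E \<noteq> {0}" "0 \<in> E"
    using assms submodulesD(2) by (auto simp: submodules_def)
  with that show ?thesis
    by auto
qed

lemma submoduleI:
  assumes "frac.subspace E" "x \<in> E" "x \<noteq> 0"
  shows "E \<in> submodules"
  using assms by (auto simp: submodules_def)

lemma ideal_eq_base_ring:
  assumes "nonzero_ideal J" "1 \<in> J"
  shows "J = base_ring"
  using assms subspaceD(3)[of J _ 1] by (fastforce simp: nonzero_ideal_def submodules_def)

section \<open>Products of submodules\<close>

lemma mod_prod_subset:
  assumes "frac.subspace W" "\<And>x y. x \<in> E \<Longrightarrow> y \<in> F \<Longrightarrow> x * y \<in> W"
  shows "mod_prod E F \<subseteq> W"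
  unfolding mod_prod_def using assms by (intro frac.span_minimal) auto

lemma mod_prodI: "x \<in> E \<Longrightarrow> y \<in> F \<Longrightarrow> x * y \<in> mod_prod E F"
  unfolding mod_prod_def by (auto intro!: frac.span_base)

lemma subspace_mod_prod [simp]: "frac.subspace (mod_prod E F)"
  by (simp add: mod_prod_def)

lemma mod_prod_commute: "mod_prod E F = mod_prod F E"
  for E F :: "'a::idom fract set"
proof -
  have "mod_prod E F \<subseteq> mod_prod F E" for E F :: "'a fract set"
    by (rule mod_prod_subset) (simp, subst mult.commute, rule mod_prodI)
  then show ?thesis
    by blast
qed

lemma mod_prod_mono: "E \<subseteq> E' \<Longrightarrow> F \<subseteq> F' \<Longrightarrow> mod_prod E F \<subseteq> mod_prod E' F'"
  unfolding mod_prod_def by (rule frac.span_mono) blast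

lemma mod_prod_base_ring:
  fixes E :: "'a::idom fract set"
  assumes "frac.subspace E"
  shows "mod_prod E base_ring = E"
proof
  show "mod_prod E base_ring \<subseteq> E"
  proof (rule mod_prod_subset[OF assms])
    fix x y :: "'a fract"
    assume "x \<in> E" "y \<in> base_ring"
    then show "x * y \<in> E"
      using subspaceD(3)[OF assms, of y x] by (simp add: mult.commute)
  qed
  show "E \<subseteq> mod_prod E base_ring"
    using mod_prodI[of _ E 1 base_ring] by auto
qed

text \<open>Membership in the right-hand side is linear in each factor separately, so it is checked
  on generators one factor at a time, without an associativity law for \<open>mod_prod\<close>.
  Applied in both directions it gives (II)(JJ) = (IJ)(IJ), hence idempotence of products.\<close>

lemma mod_prod_interchange:
  "mod_prod (mod_prod A B) (mod_prod C E) \<subseteq> mod_prod (mod_prod A C) (mod_prod B E)"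
proof (rule mod_prod_subset)
  let ?W = "mod_prod (mod_prod A C) (mod_prod B E)"
  fix x y
  assume x: "x \<in> mod_prod A B" and y: "y \<in> mod_prod C E"
  have "mod_prod A B \<subseteq> {x. \<forall>y\<in>mod_prod C E. x * y \<in> ?W}"
  proof (rule mod_prod_subset)
    show "frac.subspace {x. \<forall>y\<in>mod_prod C E. x * y \<in> ?W}"
      using subspace_mod_prod[of "mod_prod A C" "mod_prod B E"]
      by (auto simp: subspace_iff distrib_right mult.assoc)
    fix a b
    assume ab: "a \<in> A" "b \<in> B"
    have "mod_prod C E \<subseteq> {y. y * (a * b) \<in> ?W}"
    proof (rule mod_prod_subset)
      fix c e
      assume "c \<in> C" "e \<in> E"
      with ab have "(a * c) * (b * e) \<in> ?W"
        by (intro mod_prodI)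
      then show "c * e \<in> {y. y * (a * b) \<in> ?W}"
        by (simp add: mult_ac)
    qed (simp add: subspace_vimage_mult)
    then show "a * b \<in> {x. \<forall>y\<in>mod_prod C E. x * y \<in> ?W}"
      by (auto simp: mult_ac)
  qed
  with x y show "x * y \<in> ?W"
    by auto
qed simp

lemma nonzero_ideal_mod_prod:
  fixes I J :: "'a::idom fract set"
  assumes "nonzero_ideal I" "nonzero_ideal J"
  shows "nonzero_ideal (mod_prod I J)"
proof -
  have I: "I \<in> submodules" "I \<subseteq> base_ring" and J: "J \<in> submodules" "J \<subseteq> base_ring"
    using assms by (simp_all add: nonzero_ideal_def)
  obtain x where x: "x \<in> I" "x \<noteq> 0"
    by (rule submodule_has_nonzero[OF I(1)])
  obtain y where y: "y \<in> J" "y \<noteq> 0"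
    by (rule submodule_has_nonzero[OF J(1)])
  have "x * y \<noteq> 0"
    using x y by simp
  moreover have "x * y \<in> mod_prod I J"
    using x y by (intro mod_prodI)
  ultimately have "mod_prod I J \<in> submodules"
    by (intro submoduleI[OF subspace_mod_prod])
  moreover have "mod_prod I J \<subseteq> base_ring"
  proof (rule mod_prod_subset[OF subspace_base_ring])
    fix x y :: "'a fract"
    assume "x \<in> I" "y \<in> J"
    then have "x \<in> base_ring" "y \<in> base_ring"
      using I J by blast+
    then show "x * y \<in> base_ring"
      by (rule base_ring_closed)
  qed
  ultimately show ?thesis
    by (simp add: nonzero_ideal_def)
qed

lemma nonzero_ideal_base_ring: "nonzero_ideal base_ring"
  by (simp add: nonzero_ideal_def base_ring_submodule)

lemma nonzero_ideal_mod_prod_list: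
  "(\<And>P. P \<in> set Ps \<Longrightarrow> nonzero_ideal P) \<Longrightarrow> nonzero_ideal (mod_prod_list Ps)"
  by (induction Ps)
    (simp_all add: mod_prod_list_def nonzero_ideal_mod_prod nonzero_ideal_base_ring)

lemma nonzero_idealD:
  assumes "nonzero_ideal I"
  shows "frac.subspace I" "I \<in> submodules" "I \<subseteq> base_ring"
  using assms submodulesD(1)[of I] by (simp_all add: nonzero_ideal_def)

lemma mod_prod_list_subset:
  assumes "P \<in> set Ps" "\<And>P. P \<in> set Ps \<Longrightarrow> nonzero_ideal P"
  shows "mod_prod_list Ps \<subseteq> P"
  using assms
proof (induction Ps)
  case (Cons Q Ps)
  let ?R = "mod_prod_list Ps"
  have Q: "frac.subspace Q" "Q \<subseteq> base_ring"
    using Cons.prems(2)[of Q] by (simp_all add: nonzero_idealD)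
  have R: "nonzero_ideal ?R"
    using Cons.prems(2) by (intro nonzero_ideal_mod_prod_list) simp
  have eq: "mod_prod_list (Q # Ps) = mod_prod Q ?R"
    by (simp add: mod_prod_list_def)
  show ?case
  proof (cases "P = Q")
    case True
    have "mod_prod Q ?R \<subseteq> mod_prod Q base_ring"
      using nonzero_idealD(3)[OF R] by (intro mod_prod_mono) simp_all
    then show ?thesis
      using True mod_prod_base_ring[OF Q(1)] eq by simp
  next
    case False
    have "mod_prod ?R Q \<subseteq> mod_prod ?R base_ring"
      using Q(2) by (intro mod_prod_mono) simp_all
    then have "mod_prod Q ?R \<subseteq> ?R"
      using mod_prod_base_ring[OF nonzero_idealD(1)[OF R]] mod_prod_commute[of Q ?R] by simp
    moreover have "?R \<subseteq> P"
      using Cons.prems False by (intro Cons.IH) simp_all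
    ultimately show ?thesis
      using eq by simp
  qed
qed simp

text \<open>For a prime M and a submodule E this is E D_M, the fractions e/s with s in D - M, kept
  as a subset of K so that localizations at different M can be intersected and compared.\<close>

definition localize :: "'d::idom fract set \<Rightarrow> 'd fract set \<Rightarrow> 'd fract set" where
  "localize M E = {x. \<exists>s\<in>base_ring - M. s * x \<in> E}"

lemma localizeI: "s \<in> base_ring \<Longrightarrow> s \<notin> M \<Longrightarrow> s * x \<in> E \<Longrightarrow> x \<in> localize M E"
  by (auto simp: localize_def)

lemma localizeE:
  assumes "x \<in> localize M E"
  obtains s where "s \<in> base_ring" "s \<notin> M" "s * x \<in> E"
  using assms by (auto simp: localize_def)

lemma localize_mono: "E \<subseteq> F \<Longrightarrow> localize M E \<subseteq> localize M F"
  by (auto simp: localize_def)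

lemma prime_idealD:
  assumes "prime_ideal M"
  shows "frac.subspace M" "M \<subseteq> base_ring" "0 \<in> M" "1 \<notin> M"
    and "a \<in> base_ring \<Longrightarrow> b \<in> base_ring \<Longrightarrow> a * b \<in> M \<Longrightarrow> a \<in> M \<or> b \<in> M"
proof -
  show M: "frac.subspace M" "M \<subseteq> base_ring"
    and "a \<in> base_ring \<Longrightarrow> b \<in> base_ring \<Longrightarrow> a * b \<in> M \<Longrightarrow> a \<in> M \<or> b \<in> M"
    using assms by (auto simp: prime_ideal_def)
  show "0 \<in> M"
    using M(1) by (rule subspaceD)
  show "1 \<notin> M"
  proof
    assume "1 \<in> M"
    then have "base_ring \<subseteq> M"
      using subspaceD(3)[OF M(1), of _ 1] by auto
    with assms show False
      by (auto simp: prime_ideal_def)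
  qed
qed

context
  fixes M :: "'d::idom fract set"
  assumes M: "prime_ideal M"
begin

lemma prime_complement_mult:
  "s \<in> base_ring \<Longrightarrow> s \<notin> M \<Longrightarrow> t \<in> base_ring \<Longrightarrow> t \<notin> M \<Longrightarrow> s * t \<notin> M"
  using prime_idealD(5)[OF M, of s t] by auto

lemma localize_superset: "E \<subseteq> localize M E"
  using prime_idealD(4)[OF M] by (auto intro: localizeI[of 1])

lemma localize_mult:
  assumes "x \<in> localize M E" "y \<in> localize M F"
    and "\<And>x y. x \<in> E \<Longrightarrow> y \<in> F \<Longrightarrow> x * y \<in> G"
  shows "x * y \<in> localize M G"
proof -
  obtain s t where "s \<in> base_ring" "s \<notin> M" "s * x \<in> E" "t \<in> base_ring" "t \<notin> M" "t * y \<in> F"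
    using assms(1,2) by (elim localizeE)
  then show ?thesis
    using assms(3)[of "s * x" "t * y"] prime_complement_mult[of s t]
    by (intro localizeI[of "s * t"]) (auto simp: mult_ac)
qed

lemma localize_scale:
  assumes "frac.subspace E" "x \<in> localize M base_ring" "y \<in> localize M E"
  shows "x * y \<in> localize M E"
  using assms(2,3) by (rule localize_mult) (rule subspaceD(3)[OF assms(1)])

lemma subspace_localize:
  assumes "frac.subspace E"
  shows "frac.subspace (localize M E)"
proof (rule subspaceI)
  show "0 \<in> localize M E"
    using localize_superset subspaceD(1)[OF assms] by auto
next
  fix x y :: "'d fract"
  assume "x \<in> localize M E" "y \<in> localize M E"
  then obtain s t where st: "s \<in> base_ring" "s \<notin> M" "s * x \<in> E" "t \<in> base_ring" "t \<notin> M" "t * y \<in> E"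
    by (elim localizeE)
  have "t * (s * x) + s * (t * y) \<in> E"
    using st by (intro subspaceD(2)[OF assms]) (simp_all add: subspaceD(3)[OF assms])
  then show "x + y \<in> localize M E"
    using st prime_complement_mult[of s t]
    by (intro localizeI[of "s * t"]) (auto simp: algebra_simps)
next
  fix d x :: "'d fract"
  assume "d \<in> base_ring" "x \<in> localize M E"
  then show "d * x \<in> localize M E"
    using localize_scale[OF assms] localize_superset[of base_ring] by blast
qed

text \<open>Denominators outside a prime multiply to one outside it, so a second localization adds
  nothing. This reduces inclusions between localizations to testing the elements of E.\<close>

lemma localize_subset:
  assumes "E \<subseteq> localize M F"
  shows "localize M E \<subseteq> localize M F"
proof
  fix x
  assume "x \<in> localize M E"
  then obtain s where s: "s \<in> base_ring" "s \<notin> M" "s * x \<in> localize M F"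
    using assms by (auto elim!: localizeE)
  then obtain t where "t \<in> base_ring" "t \<notin> M" "t * (s * x) \<in> F"
    by (elim localizeE)
  with s show "x \<in> localize M F"
    using prime_complement_mult[of t s] by (intro localizeI[of "t * s"]) (auto simp: mult_ac)
qed

lemma localize_mod_prod_mono:
  assumes "E \<subseteq> localize M E'" "F \<subseteq> localize M F'"
  shows "localize M (mod_prod E F) \<subseteq> localize M (mod_prod E' F')"
  using assms
  by (intro localize_subset mod_prod_subset subspace_localize localize_mult[of _ E' _ F'])
    (auto intro: mod_prodI)

lemma localize_mod_prod_cong:
  assumes "localize M E = localize M E'" "localize M F = localize M F'"
  shows "localize M (mod_prod E F) = localize M (mod_prod E' F')"
  using assms localize_superset[of E] localize_superset[of E'] localize_superset[of F]
    localize_superset[of F']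
  by (intro subset_antisym localize_mod_prod_mono) auto

lemma localize_cancel:
  assumes "s \<in> base_ring" "s \<notin> M" "s * x \<in> localize M E"
  shows "x \<in> localize M E"
proof -
  obtain t where "t \<in> base_ring" "t \<notin> M" "t * (s * x) \<in> E"
    using assms(3) by (rule localizeE)
  then show ?thesis
    using assms prime_complement_mult[of t s] by (intro localizeI[of "t * s"]) (auto simp: mult_ac)
qed

lemma localize_self_Int: "localize M M \<inter> base_ring = M"
proof
  show "localize M M \<inter> base_ring \<subseteq> M"
  proof
    fix x
    assume x: "x \<in> localize M M \<inter> base_ring"
    then obtain s where "s \<in> base_ring" "s \<notin> M" "s * x \<in> M"
      by (auto elim: localizeE)
    with x show "x \<in> M"
      using prime_idealD(5)[OF M, of s x] by auto
  qed
  show "M \<subseteq> localize M M \<inter> base_ring"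
    using localize_superset prime_idealD(2)[OF M] by auto
qed

lemma localize_self_subset: "localize M M \<subseteq> localize M base_ring"
  using prime_idealD(2)[OF M] by (rule localize_mono)

lemma localize_not_subset:
  assumes "E \<subseteq> base_ring" "frac.subspace E" "\<not> E \<subseteq> M"
  shows "localize M E = localize M base_ring"
proof (rule subset_antisym[OF localize_mono[OF assms(1)]])
  obtain s where "s \<in> E" "s \<notin> M"
    using assms by auto
  then have "base_ring \<subseteq> localize M E"
    using assms subspaceD(3)[OF assms(2), of _ s]
    by (auto intro!: localizeI[of s] simp: mult.commute)
  then show "localize M base_ring \<subseteq> localize M E"
    by (rule localize_subset)
qed

lemma localize_prime_Int:
  assumes "prime_ideal P" "P \<subseteq> M"
  shows "localize M P \<inter> base_ring = P"
proof
  show "localize M P \<inter> base_ring \<subseteq> P"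
    using assms(2) prime_idealD(5)[OF assms(1)] by (fastforce elim: localizeE)
  show "P \<subseteq> localize M P \<inter> base_ring"
    using localize_superset prime_idealD(2)[OF assms(1)] by auto
qed

lemma mod_prod_not_subset_prime:
  assumes "E \<subseteq> base_ring" "F \<subseteq> base_ring" "\<not> E \<subseteq> M" "\<not> F \<subseteq> M"
  shows "\<not> mod_prod E F \<subseteq> M"
proof -
  obtain x y where "x \<in> E" "x \<notin> M" "y \<in> F" "y \<notin> M"
    using assms by auto
  then show ?thesis
    using assms mod_prodI[of x E y F] prime_complement_mult[of x y] by auto
qed

text \<open>A factor not contained in M has an element outside M and therefore localizes to D_M,
  which acts as the neutral element.\<close>

lemma localize_mod_prod_list_filter:
  assumes "\<And>P. P \<in> set Ps \<Longrightarrow> nonzero_ideal P"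
  shows "localize M (mod_prod_list Ps) = localize M (mod_prod_list (filter (\<lambda>P. P \<subseteq> M) Ps))"
  using assms
proof (induction Ps)
  case (Cons P Ps)
  let ?R = "mod_prod_list Ps" and ?R' = "mod_prod_list (filter (\<lambda>P. P \<subseteq> M) Ps)"
  have IH: "localize M ?R = localize M ?R'"
    using Cons by simp
  have P: "P \<subseteq> base_ring" "frac.subspace P"
    using Cons.prems[of P] by (simp_all add: nonzero_idealD)
  show ?case
  proof (cases "P \<subseteq> M")
    case True
    then show ?thesis
      using localize_mod_prod_cong[OF refl IH, of P] by (simp add: mod_prod_list_def)
  next
    case False
    have R': "frac.subspace ?R'"
      using Cons.prems by (intro nonzero_idealD(1) nonzero_ideal_mod_prod_list) auto
    have "localize M (mod_prod P ?R) = localize M (mod_prod base_ring ?R')"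
      using IH localize_not_subset[OF P False] by (rule localize_mod_prod_cong[rotated])
    then show ?thesis
      using False mod_prod_base_ring[OF R']
      by (simp add: mod_prod_list_def mod_prod_commute[of base_ring])
  qed
qed simp

lemma localize_mod_prod_list_none:
  assumes "\<And>P. P \<in> set Ps \<Longrightarrow> nonzero_ideal P" "\<And>P. P \<in> set Ps \<Longrightarrow> \<not> P \<subseteq> M"
  shows "localize M (mod_prod_list Ps) = localize M base_ring"
proof -
  have "filter (\<lambda>P. P \<subseteq> M) Ps = []"
    using assms(2) by (intro filter_False) simp
  then show ?thesis
    using localize_mod_prod_list_filter[of Ps] assms(1) by (simp add: mod_prod_list_def)
qed

lemma localize_mod_prod_list_single:
  assumes "\<And>P. P \<in> set Ps \<Longrightarrow> nonzero_ideal P" "distinct Ps" "Q \<in> set Ps" "Q \<subseteq> M"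
    and "\<And>P. P \<in> set Ps \<Longrightarrow> P \<subseteq> M \<Longrightarrow> P = Q"
  shows "localize M (mod_prod_list Ps) = localize M Q"
proof -
  let ?Qs = "filter (\<lambda>P. P \<subseteq> M) Ps"
  have "distinct ?Qs"
    using assms(2) by simp
  moreover have "set ?Qs = {Q}"
    using assms(3,4) assms(5) unfolding set_filter by blast
  ultimately have "?Qs = [Q]"
    by (rule distinct_eq_singleton)
  moreover have "mod_prod Q base_ring = Q"
    using assms(1,3) by (intro mod_prod_base_ring nonzero_idealD(1))
  ultimately show ?thesis
    using localize_mod_prod_list_filter[of Ps] assms(1) by (simp add: mod_prod_list_def)
qed

text \<open>Choose an element of D outside M in each module; their product lies in all the modules
  and, M being prime, still avoids M. Both halves of the divisoriality criterion take their element
  d from here.\<close>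

lemma finite_Inter_not_subset_prime:
  assumes "finite \<A>" "\<And>A. A \<in> \<A> \<Longrightarrow> frac.subspace A \<and> \<not> A \<inter> base_ring \<subseteq> M"
  shows "\<exists>d\<in>base_ring - M. \<forall>A\<in>\<A>. d \<in> A"
  using assms
proof (induction \<A>)
  case empty
  then show ?case
    using prime_idealD(4)[OF M] by auto
next
  case (insert A \<A>)
  then obtain d where d: "d \<in> base_ring" "d \<notin> M" "\<forall>A\<in>\<A>. d \<in> A"
    by auto
  obtain e where e: "e \<in> base_ring" "e \<notin> M" "e \<in> A"
    using insert.prems[of A] by auto
  have "e * d \<in> B" if "B \<in> insert A \<A>" for B
  proof (cases "B = A")
    case True
    then show ?thesis
      using d(1) e(3) subspaceD(3)[of A d e] insert.prems(1)[of A] by (simp add: mult.commute)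
  next
    case False
    then show ?thesis
      using that d(3) e(1) subspaceD(3)[of B e d] insert.prems(1)[of B] by simp
  qed
  with d e show ?case
    using prime_complement_mult[of e d] by (intro bexI[of _ "e * d"]) auto
qed

end

section \<open>Semistar operations of finite type\<close>

locale semistar_operation =
  fixes st :: "'d::idom fract set \<Rightarrow> 'd fract set"
  assumes semistar: "semistar st"
begin

abbreviation sf :: "'d fract set \<Rightarrow> 'd fract set" where
  "sf \<equiv> finite_type st"

lemma st_submodule: "E \<in> submodules \<Longrightarrow> st E \<in> submodules"
  using semistar by (simp add: semistar_def)

lemma st_image_mult: "x \<noteq> 0 \<Longrightarrow> E \<in> submodules \<Longrightarrow> st ((*) x ` E) = (*) x ` st E"
  using semistar by (simp add: semistar_def)

lemma st_mono: "E \<in> submodules \<Longrightarrow> F \<in> submodules \<Longrightarrow> E \<subseteq> F \<Longrightarrow> st E \<subseteq> st F"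
  using semistar by (simp add: semistar_def)

lemma st_superset: "E \<in> submodules \<Longrightarrow> E \<subseteq> st E"
  using semistar by (simp add: semistar_def)

lemma st_idem: "E \<in> submodules \<Longrightarrow> st (st E) = st E"
  using semistar by (simp add: semistar_def)

lemma sfI: "F \<in> fg_submodules \<Longrightarrow> F \<subseteq> E \<Longrightarrow> x \<in> st F \<Longrightarrow> x \<in> sf E"
  by (auto simp: finite_type_def)

lemma sfE:
  assumes "x \<in> sf E"
  obtains F where "F \<in> fg_submodules" "F \<subseteq> E" "x \<in> st F"
  using assms by (auto simp: finite_type_def)

lemma sf_mono: "E \<subseteq> F \<Longrightarrow> sf E \<subseteq> sf F"
  by (auto simp: finite_type_def)

lemma sf_superset:
  assumes "E \<in> submodules"
  shows "E \<subseteq> sf E"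
proof
  fix x
  assume x: "x \<in> E"
  have E: "frac.subspace E"
    using assms by (rule submodulesD)
  obtain y where y: "y \<in> E" "y \<noteq> 0"
    using assms by (rule submodule_has_nonzero)
  let ?F = "frac.span {x, y}"
  have F: "?F \<in> fg_submodules"
    using y(2) by (intro span_in_fg_submodules[of _ y]) auto
  moreover have "?F \<subseteq> E"
    using x y E by (intro frac.span_minimal) auto
  moreover have "x \<in> st ?F"
    using st_superset[OF fg_submodules_subset[OF F]] frac.span_base[of x "{x, y}"] by auto
  ultimately show "x \<in> sf E"
    by (rule sfI)
qed

lemma fg_submodules_sum:
  assumes "F \<in> fg_submodules" "G \<in> fg_submodules" "F \<subseteq> E" "G \<subseteq> E" "frac.subspace E"
  obtains H where "H \<in> fg_submodules" "F \<subseteq> H" "G \<subseteq> H" "H \<subseteq> E"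
proof -
  obtain S T where S: "finite S" "F = frac.span S" "F \<noteq> {0}" and T: "finite T" "G = frac.span T"
    using assms by (auto simp: fg_submodules_def)
  have sub: "F \<subseteq> frac.span (S \<union> T)" "G \<subseteq> frac.span (S \<union> T)"
    unfolding S T by (simp_all add: frac.span_mono)
  moreover have "frac.span (S \<union> T) \<in> fg_submodules"
    using S T sub frac.span_zero[of S] by (auto simp: fg_submodules_def intro!: exI[of _ "S \<union> T"])
  moreover have "frac.span (S \<union> T) \<subseteq> E"
    using assms S T frac.span_superset by (intro frac.span_minimal) auto
  ultimately show ?thesis
    using that by blast
qed

text \<open>The finitely generated submodules of E are directed by \<open>fg_submodules_sum\<close>,
  so one F captures finitely many elements at once. Additivity and idempotence of the closure rest
  on this.\<close>

lemma finite_subset_sf: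
  assumes "finite S" "S \<subseteq> sf E" "E \<in> submodules"
  obtains F where "F \<in> fg_submodules" "F \<subseteq> E" "S \<subseteq> st F"
proof -
  have E: "frac.subspace E"
    using assms by (simp add: submodules_def)
  have "\<exists>F\<in>fg_submodules. F \<subseteq> E \<and> S \<subseteq> st F"
    using assms(1,2)
  proof (induction S)
    case empty
    have "0 \<in> sf E"
      using sf_superset[OF assms(3)] subspaceD(1)[OF E] by auto
    then obtain F where "F \<in> fg_submodules" "F \<subseteq> E"
      by (rule sfE)
    then show ?case
      by auto
  next
    case (insert x S)
    then obtain F where F: "F \<in> fg_submodules" "F \<subseteq> E" "S \<subseteq> st F"
      by auto
    have "x \<in> sf E"
      using insert.prems by auto
    then obtain G where G: "G \<in> fg_submodules" "G \<subseteq> E" "x \<in> st G"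
      by (rule sfE)
    obtain H where H: "H \<in> fg_submodules" "F \<subseteq> H" "G \<subseteq> H" "H \<subseteq> E"
      using F(1) G(1) F(2) G(2) E by (rule fg_submodules_sum)
    have "st F \<subseteq> st H" "st G \<subseteq> st H"
      using F G H by (simp_all add: st_mono fg_submodules_subset)
    with F G H have "insert x S \<subseteq> st H"
      by auto
    with H show ?case
      by auto
  qed
  with that show ?thesis
    by auto
qed

lemma sf_submodule:
  assumes "E \<in> submodules"
  shows "sf E \<in> submodules"
proof -
  have sub: "frac.subspace (st F)" if "F \<in> fg_submodules" for F
    using st_submodule[OF fg_submodules_subset[OF that]] by (simp add: submodules_def)
  have "frac.subspace (sf E)"
  proof (rule subspaceI)
    show "0 \<in> sf E"
      using sf_superset[OF assms] submodulesD(2)[OF assms] by (rule subsetD)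
  next
    fix x y
    assume "x \<in> sf E" "y \<in> sf E"
    then obtain F where F: "F \<in> fg_submodules" "F \<subseteq> E" "{x, y} \<subseteq> st F"
      using finite_subset_sf[of "{x, y}" E] assms by auto
    then show "x + y \<in> sf E"
      using subspaceD(2)[OF sub] by (intro sfI[OF F(1,2)]) auto
  next
    fix d x :: "'d fract"
    assume d: "d \<in> base_ring" and "x \<in> sf E"
    from this(2) obtain F where F: "F \<in> fg_submodules" "F \<subseteq> E" "x \<in> st F"
      by (rule sfE)
    then show "d * x \<in> sf E"
      using subspaceD(3)[OF sub[OF F(1)] d] by (intro sfI[OF F(1,2)])
  qed
  moreover obtain x where "x \<in> E" "x \<noteq> 0"
    using assms by (rule submodule_has_nonzero)
  ultimately show ?thesis
    using sf_superset[OF assms] by (blast intro: submoduleI)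
qed

lemma sf_idem:
  assumes "E \<in> submodules"
  shows "sf (sf E) = sf E"
proof
  show "sf (sf E) \<subseteq> sf E"
  proof
    fix x
    assume "x \<in> sf (sf E)"
    then obtain F where F: "F \<in> fg_submodules" "F \<subseteq> sf E" "x \<in> st F"
      by (rule sfE)
    then obtain S where S: "finite S" "F = frac.span S"
      by (auto simp: fg_submodules_def)
    then obtain G where G: "G \<in> fg_submodules" "G \<subseteq> E" "S \<subseteq> st G"
      using finite_subset_sf[of S E] F frac.span_superset[of S] assms by blast
    have Gs: "G \<in> submodules"
      using G by (simp add: fg_submodules_subset)
    have "F \<subseteq> st G"
      unfolding S using G st_submodule[OF Gs] by (auto simp: submodules_def frac.span_minimal)
    then have "st F \<subseteq> st G"
      using st_mono[of F "st G"] F Gs by (simp add: fg_submodules_subset st_submodule st_idem)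
    with F G show "x \<in> sf E"
      by (intro sfI[OF G(1,2)]) auto
  qed
  show "sf E \<subseteq> sf (sf E)"
    using assms by (intro sf_superset sf_submodule)
qed

lemma sf_base_ring: "sf base_ring = st base_ring"
proof
  show "sf base_ring \<subseteq> st base_ring"
    using st_mono[OF fg_submodules_subset base_ring_submodule] by (auto elim!: sfE)
  show "st base_ring \<subseteq> sf base_ring"
    using sfI[OF base_ring_fg subset_refl] by auto
qed

text \<open>If F inside J witnesses that 1 is in the closure of J, then xF inside E witnesses x,
  because \<open>st\<close> commutes with multiplication by x. The typical J is the ideal of all d
  in D with dx in E.\<close>

lemma mem_sf_of_one_mem:
  assumes "1 \<in> sf J" "x \<noteq> 0" "\<And>d. d \<in> J \<Longrightarrow> x * d \<in> E"
  shows "x \<in> sf E"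
proof -
  obtain F where F: "F \<in> fg_submodules" "F \<subseteq> J" "1 \<in> st F"
    using assms(1) by (rule sfE)
  have "x * 1 \<in> (*) x ` st F"
    using F(3) by (rule imageI)
  then have "x \<in> st ((*) x ` F)"
    using F assms by (simp add: st_image_mult fg_submodules_subset)
  moreover have "(*) x ` F \<in> fg_submodules" "(*) x ` F \<subseteq> E"
    using F assms by (auto intro: fg_submodules_image_mult)
  ultimately show ?thesis
    by (intro sfI)
qed

lemma nonzero_ideal_sf_Int:
  assumes "nonzero_ideal J"
  shows "nonzero_ideal (sf J \<inter> base_ring)"
proof -
  have J: "J \<in> submodules" "J \<subseteq> base_ring"
    using assms by (auto simp: nonzero_ideal_def)
  have "frac.subspace (sf J \<inter> base_ring)"
    using sf_submodule[OF J(1)] subspace_base_ring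
    by (auto simp: submodules_def intro: frac.subspace_inter)
  moreover obtain x where "x \<in> J" "x \<noteq> 0"
    using J(1) by (rule submodule_has_nonzero)
  ultimately have "sf J \<inter> base_ring \<in> submodules"
    using J(2) sf_superset[OF J(1)] by (blast intro: submoduleI)
  then show ?thesis
    by (simp add: nonzero_ideal_def)
qed

lemma quasi_ideal_sf_Int:
  assumes "nonzero_ideal J"
  shows "quasi_ideal st (sf J \<inter> base_ring)"
proof -
  let ?I = "sf J \<inter> base_ring"
  have J: "J \<in> submodules" "J \<subseteq> base_ring"
    using assms by (auto simp: nonzero_ideal_def)
  have I: "nonzero_ideal ?I"
    by (rule nonzero_ideal_sf_Int[OF assms])
  have "sf ?I \<subseteq> sf J"
    using sf_mono[of ?I "sf J"] sf_idem[OF J(1)] by auto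
  moreover have "?I \<subseteq> sf ?I"
    using I by (intro sf_superset) (simp add: nonzero_ideal_def)
  ultimately show ?thesis
    using I by (auto simp: quasi_ideal_def)
qed

section \<open>Quasi-maximal ideals: existence and primality\<close>

lemma quasi_maximalD:
  assumes "quasi_maximal st M"
  shows "nonzero_ideal M" "sf M \<inter> base_ring = M" "1 \<notin> sf M"
proof -
  show M: "nonzero_ideal M" "sf M \<inter> base_ring = M"
    using assms by (auto simp: quasi_maximal_def quasi_ideal_def)
  show "1 \<notin> sf M"
    using assms M ideal_eq_base_ring[OF M(1)] by (auto simp: quasi_maximal_def)
qed

lemma quasi_maximal_eq:
  assumes "quasi_maximal st M" "quasi_maximal st N" "M \<subseteq> N"
  shows "M = N"
proof -
  have "quasi_ideal st N \<and> N \<noteq> base_ring \<and> M \<subseteq> N"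
    using assms(2,3) by (simp only: quasi_maximal_def simp_thms)
  then show ?thesis
    using assms(1) unfolding quasi_maximal_def by metis
qed

text \<open>Zorn's lemma is applied to the ideals above J whose closure omits 1. Chains have upper
  bounds because 1 in the closure of a union is witnessed by finitely many generators, all lying in
  one member. A maximal M is a quasi-ideal since the trace of \<open>sf M\<close> on D belongs to
  the same family.\<close>

lemma exists_quasi_maximal:
  assumes J: "nonzero_ideal J" "1 \<notin> sf J"
  obtains M where "quasi_maximal st M" "J \<subseteq> M"
proof -
  let ?A = "{I. nonzero_ideal I \<and> 1 \<notin> sf I \<and> J \<subseteq> I}"
  have "\<exists>M\<in>?A. \<forall>X\<in>?A. M \<subseteq> X \<longrightarrow> X = M"
  proof (rule subset_Zorn_nonempty)
    show "?A \<noteq> {}"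
      using J by auto
    fix C
    assume C: "C \<noteq> {}" "subset.chain ?A C"
    then have CA: "C \<subseteq> ?A" and lin: "\<And>X Y. X \<in> C \<Longrightarrow> Y \<in> C \<Longrightarrow> X \<subseteq> Y \<or> Y \<subseteq> X"
      by (auto simp: subset_chain_def)
    obtain X0 where X0: "X0 \<in> C"
      using C by auto
    have sub: "frac.subspace X" "X \<subseteq> base_ring" "J \<subseteq> X" "1 \<notin> sf X" if "X \<in> C" for X
      using CA that nonzero_idealD[of X] by auto
    have "frac.subspace (\<Union>C)"
    proof (rule subspaceI)
      show "0 \<in> \<Union>C"
        using X0 subspaceD(1)[OF sub(1)[OF X0]] by blast
    next
      fix x y
      assume "x \<in> \<Union>C" "y \<in> \<Union>C"
      then obtain X where "X \<in> C" "x \<in> X" "y \<in> X"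
        using lin by blast
      then show "x + y \<in> \<Union>C"
        using subspaceD(2)[OF sub(1)] by blast
    next
      fix d x :: "'d fract"
      assume "d \<in> base_ring" "x \<in> \<Union>C"
      then show "d * x \<in> \<Union>C"
        using subspaceD(3)[OF sub(1)] by blast
    qed
    moreover have JC: "J \<subseteq> \<Union>C"
      using X0 sub(3) by blast
    moreover have "\<Union>C \<subseteq> base_ring"
      using sub(2) by blast
    moreover obtain x where "x \<in> J" "x \<noteq> 0"
      using nonzero_idealD(2)[OF J(1)] by (rule submodule_has_nonzero)
    ultimately have "nonzero_ideal (\<Union>C)"
      unfolding nonzero_ideal_def by (blast intro: submoduleI)
    moreover have "1 \<notin> sf (\<Union>C)"
    proof
      assume "1 \<in> sf (\<Union>C)"
      then obtain F where F: "F \<in> fg_submodules" "F \<subseteq> \<Union>C" "1 \<in> st F"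
        by (rule sfE)
      then obtain S where S: "finite S" "F = frac.span S"
        by (auto simp: fg_submodules_def)
      have "S \<subseteq> \<Union>C"
        using F S frac.span_superset[of S] by auto
      with S obtain X where X: "X \<in> C" "S \<subseteq> X"
        using C by (metis finite_subset_Union_chain)
      then have "F \<subseteq> X"
        unfolding S by (intro frac.span_minimal sub)
      with F X show False
        using sub(4)[of X] by (auto intro: sfI)
    qed
    ultimately show "\<Union>C \<in> ?A"
      using JC by simp
  qed
  then obtain M where "M \<in> ?A" and *: "\<forall>X\<in>?A. M \<subseteq> X \<longrightarrow> X = M"
    by (rule bexE)
  then have M: "nonzero_ideal M" "1 \<notin> sf M" "J \<subseteq> M"
    by simp_all
  have max: "X = M" if "nonzero_ideal X" "1 \<notin> sf X" "M \<subseteq> X" for X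
    using * that M(3) by auto
  have Ms: "M \<in> submodules" "M \<subseteq> base_ring"
    using M by (auto simp: nonzero_ideal_def)
  have sub: "M \<subseteq> sf M \<inter> base_ring"
    using Ms sf_superset[OF Ms(1)] by auto
  have "sf (sf M \<inter> base_ring) \<subseteq> sf M"
    using sf_mono[of "sf M \<inter> base_ring" "sf M"] sf_idem[OF Ms(1)] by auto
  then have "sf M \<inter> base_ring = M"
    using M sub by (intro max nonzero_ideal_sf_Int) auto
  then have "quasi_ideal st M"
    using M by (simp add: quasi_ideal_def)
  moreover have "M \<noteq> base_ring"
    using M(2) sf_superset[OF Ms(1)] by auto
  moreover have "X = M" if X: "quasi_ideal st X" "X \<noteq> base_ring" "M \<subseteq> X" for X
  proof (rule max)
    show "nonzero_ideal X"
      using X by (simp add: quasi_ideal_def)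
    then show "1 \<notin> sf X"
      using X ideal_eq_base_ring[of X] by (auto simp: quasi_ideal_def)
  qed (use X M in auto)
  ultimately have "quasi_maximal st M"
    by (auto simp: quasi_maximal_def)
  then show ?thesis
    using M(3) by (rule that)
qed

text \<open>If ab is in M and a is not, the ideal of all d with db in M contains both M and a. By
  maximality its closure contains 1, and \<open>mem_sf_of_one_mem\<close> puts b into the closure of
  M.\<close>

lemma quasi_maximal_prime:
  assumes "quasi_maximal st M"
  shows "prime_ideal M"
proof -
  have M: "frac.subspace M" "M \<in> submodules" "M \<subseteq> base_ring" "sf M \<inter> base_ring = M" "1 \<notin> sf M"
    using quasi_maximalD[OF assms] nonzero_idealD[of M] by simp_all
  have "b \<in> M" if ab: "a \<in> base_ring" "b \<in> base_ring" "a * b \<in> M" "a \<notin> M" for a b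
  proof -
    let ?J = "{d. d * b \<in> M} \<inter> base_ring"
    obtain x where x: "x \<in> M" "x \<noteq> 0"
      using M(2) by (rule submodule_has_nonzero)
    have MJ: "M \<subseteq> ?J"
      using M(3) ab(2) subspaceD(3)[OF M(1), of b] by (auto simp: mult.commute)
    have "frac.subspace ?J"
      using M(1) subspace_base_ring by (intro frac.subspace_inter subspace_vimage_mult)
    then have J: "?J \<in> submodules"
      using subsetD[OF MJ x(1)] x(2) by (rule submoduleI)
    then have "nonzero_ideal ?J"
      by (simp add: nonzero_ideal_def)
    then have q: "quasi_ideal st (sf ?J \<inter> base_ring)"
      by (rule quasi_ideal_sf_Int)
    have sub: "?J \<subseteq> sf ?J \<inter> base_ring"
      using sf_superset[OF J] by auto
    then have "M \<subseteq> sf ?J \<inter> base_ring"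
      using MJ by (rule subset_trans[rotated])
    moreover have "a \<in> sf ?J \<inter> base_ring"
      using sub ab by (intro subsetD[OF sub]) simp
    ultimately have "sf ?J \<inter> base_ring = base_ring"
      using assms q ab(4) by (metis quasi_maximal_def)
    then have "1 \<in> sf ?J"
      using base_ring_closed(2) by blast
    then have "b \<in> sf M" if "b \<noteq> 0"
      using that by (rule mem_sf_of_one_mem) (simp add: mult.commute)
    then show ?thesis
      using M(4) ab(2) subspaceD(1)[OF M(1)] by (cases "b = 0") auto
  qed
  moreover have "M \<noteq> base_ring"
    using assms by (simp add: quasi_maximal_def)
  ultimately show ?thesis
    using M(1,3) unfolding prime_ideal_def by blast
qed

end

section \<open>Localizations of P-star-multiplication domains\<close>

locale pstar_md = semistar_operation st
  for st :: "'d::idom fract set \<Rightarrow> 'd fract set" +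
  assumes star_md: "star_multiplication_domain st"
begin

text \<open>If all products ua were in M, then F F^{-1} would be too, and its closure, which
  contains 1, would lie in \<open>sf M\<close>. The resulting ua is a unit of D_M, so F D_M is
  principal, generated by a.\<close>

lemma exists_unit_pairing:
  assumes M: "quasi_maximal st M" and F: "F \<in> fg_submodules"
  obtains u a where "a \<in> F" "u \<in> colon base_ring F" "u * a \<in> base_ring" "u * a \<notin> M"
proof -
  have "\<exists>a\<in>F. \<exists>u\<in>colon base_ring F. u * a \<notin> M"
  proof (rule ccontr)
    assume "\<not> (\<exists>a\<in>F. \<exists>u\<in>colon base_ring F. u * a \<notin> M)"
    then have "a * u \<in> M" if "a \<in> F" "u \<in> colon base_ring F" for a u
      using that by (auto simp: mult.commute)
    then have "mod_prod F (colon base_ring F) \<subseteq> M"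
      by (intro mod_prod_subset prime_idealD(1)[OF quasi_maximal_prime[OF M]])
    then have "sf (mod_prod F (colon base_ring F)) \<subseteq> sf M"
      by (rule sf_mono)
    moreover have "1 \<in> sf base_ring"
      using sf_superset[OF base_ring_submodule] by auto
    ultimately have "1 \<in> sf M"
      using star_md F by (auto simp: star_multiplication_domain_def)
    then show False
      using quasi_maximalD(3)[OF M] by simp
  qed
  then obtain a u where au: "a \<in> F" "u \<in> colon base_ring F" "u * a \<notin> M"
    by auto
  moreover from au(1,2) have "u * a \<in> base_ring"
    by (simp add: colon_def)
  ultimately show ?thesis
    using that by simp
qed

text \<open>Take F generated by 1 and x, so that u and ux are in D. As x is not in D_M, u must lie
  in M; then ux cannot, since otherwise uF would be contained in M. Hence 1/x = u/(ux) is in M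
  D_M.\<close>

lemma localize_valuation:
  assumes M: "quasi_maximal st M" and x: "x \<notin> localize M base_ring"
  shows "inverse x \<in> localize M M"
proof -
  note prime = quasi_maximal_prime[OF M]
  let ?F = "frac.span {1, x}"
  have F: "?F \<in> fg_submodules"
    by (rule span_in_fg_submodules[of _ 1]) auto
  obtain u a where ua: "a \<in> ?F" "u \<in> colon base_ring ?F" "u * a \<in> base_ring" "u * a \<notin> M"
    by (rule exists_unit_pairing[OF M F])
  have u: "u * 1 \<in> base_ring" "u * x \<in> base_ring"
    using ua(2) frac.span_base[of _ "{1, x}"] unfolding colon_def by blast+
  have "u \<in> M"
    using x u localizeI[of u M x base_ring] by auto
  moreover have "u * x \<notin> M"
  proof
    assume "u * x \<in> M"
    then have "?F \<subseteq> {a. a * u \<in> M}"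
      using \<open>u \<in> M\<close> prime_idealD(1)[OF prime]
      by (intro frac.span_minimal subspace_vimage_mult) (auto simp: mult.commute)
    then show False
      using ua(1,4) by (auto simp: mult.commute)
  qed
  moreover have "x \<noteq> 0"
    using \<open>u * x \<notin> M\<close> prime_idealD(3)[OF prime] by auto
  ultimately show ?thesis
    using u by (intro localizeI[of "u * x"]) (auto simp: mult.assoc)
qed

text \<open>If y were outside D_M, then 1/y would be in M D_M, giving s outside M with m = s/y in M.
  Then s = my lies in the closure of mD, hence in \<open>sf M\<close>, whose trace on D is
  M.\<close>

lemma st_base_ring_subset_localize:
  assumes M: "quasi_maximal st M"
  shows "st base_ring \<subseteq> localize M base_ring"
proof
  note prime = quasi_maximal_prime[OF M]
  fix y
  assume y: "y \<in> st base_ring"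
  show "y \<in> localize M base_ring"
  proof (rule ccontr)
    assume ny: "y \<notin> localize M base_ring"
    then have "y \<noteq> 0"
      using subspaceD(1)[OF subspace_localize[OF prime subspace_base_ring]] by auto
    obtain s where s: "s \<in> base_ring" "s \<notin> M" "s * inverse y \<in> M"
      using localize_valuation[OF M ny] by (rule localizeE)
    define m where "m = s * inverse y"
    have m: "m \<noteq> 0" "m \<in> M" "s = m * y"
      using s \<open>y \<noteq> 0\<close> prime_idealD(3)[OF prime] by (auto simp: m_def)
    have "s \<in> st ((*) m ` base_ring)"
      using y m by (simp add: st_image_mult base_ring_submodule)
    moreover have "(*) m ` base_ring \<in> fg_submodules"
      using m(1) by (intro fg_submodules_image_mult base_ring_fg)
    moreover have "(*) m ` base_ring \<subseteq> M"
      using m(2) subspaceD(3)[OF prime_idealD(1)[OF prime], of _ m] by (auto simp: mult.commute)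
    ultimately have "s \<in> sf M"
      by (intro sfI)
    with s quasi_maximalD(2)[OF M] show False
      by auto
  qed
qed

text \<open>Scaling by u moves F into D, so ux is in \<open>st base_ring\<close> and thus in D_M.
  Multiplying by a returns to F: some t outside M has t(ux)a in F, so t(ua) is a denominator of x
  outside M.\<close>

lemma sf_subset_localize:
  assumes M: "quasi_maximal st M"
  shows "sf E \<subseteq> localize M E"
proof
  note prime = quasi_maximal_prime[OF M]
  fix x
  assume "x \<in> sf E"
  then obtain F where F: "F \<in> fg_submodules" "F \<subseteq> E" "x \<in> st F"
    by (rule sfE)
  obtain u a where ua: "a \<in> F" "u \<in> colon base_ring F" "u * a \<in> base_ring" "u * a \<notin> M"
    by (rule exists_unit_pairing[OF M F(1)])
  have u: "u \<noteq> 0"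
    using ua(4) prime_idealD(3)[OF prime] by auto
  have "(*) u ` F \<in> submodules"
    using F(1) u by (intro fg_submodules_subset fg_submodules_image_mult)
  moreover have "(*) u ` F \<subseteq> base_ring"
    using ua(2) by (auto simp: colon_def)
  ultimately have "st ((*) u ` F) \<subseteq> st base_ring"
    using base_ring_submodule by (intro st_mono)
  moreover have "u * x \<in> st ((*) u ` F)"
    using F u by (simp add: st_image_mult fg_submodules_subset)
  ultimately have "u * x \<in> localize M base_ring"
    using st_base_ring_subset_localize[OF M] by auto
  then obtain t where t: "t \<in> base_ring" "t \<notin> M" "t * (u * x) \<in> base_ring"
    by (rule localizeE)
  obtain S where "F = frac.span S"
    using F(1) by (auto simp: fg_submodules_def)
  then have "t * (u * x) * a \<in> F"
    using subspaceD(3)[of F "t * (u * x)" a] t ua(1) by simp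
  then have "(t * (u * a)) * x \<in> E"
    using F(2) by (auto simp: mult_ac)
  then show "x \<in> localize M E"
    using t ua prime_complement_mult[OF prime, of t "u * a"]
    by (intro localizeI[of "t * (u * a)"]) auto
qed

text \<open>For the converse let J consist of the d in D with dx in E. That x lies in each
  localization says that J lies in no quasi-maximal ideal, so 1 is in \<open>sf J\<close>.\<close>

theorem mem_sf_iff:
  assumes E: "E \<in> submodules"
  shows "x \<in> sf E \<longleftrightarrow> (\<forall>M. quasi_maximal st M \<longrightarrow> x \<in> localize M E)"
proof
  assume "x \<in> sf E"
  then show "\<forall>M. quasi_maximal st M \<longrightarrow> x \<in> localize M E"
    using sf_subset_localize by auto
next
  assume loc: "\<forall>M. quasi_maximal st M \<longrightarrow> x \<in> localize M E"
  show "x \<in> sf E"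
  proof (cases "x = 0")
    case True
    then show ?thesis
      using submodulesD(2)[OF sf_submodule[OF E]] by simp
  next
    case False
    let ?J = "{d. d * x \<in> E} \<inter> base_ring"
    obtain y where y: "y \<in> E" "y \<noteq> 0"
      using E by (rule submodule_has_nonzero)
    \<comment> \<open>Clearing the denominator of x/y, with y a nonzero element of E, gives bx =
      (bx/y)y in E, so J is nonzero.\<close>
    obtain b where b: "b \<in> base_ring" "b \<noteq> 0" "b * (x * inverse y) \<in> base_ring"
      by (rule common_denominator)
    have "b * (x * inverse y) * y \<in> E"
      using b(3) y(1) by (rule subspaceD(3)[OF submodulesD(1)[OF E]])
    then have "b \<in> ?J"
      using b(1) y(2) by (simp add: mult.assoc)
    moreover have "frac.subspace ?J"
      using submodulesD(1)[OF E] subspace_base_ring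
      by (intro frac.subspace_inter subspace_vimage_mult)
    ultimately have J: "nonzero_ideal ?J"
      using b(2) submoduleI[of ?J b] by (simp add: nonzero_ideal_def)
    have "1 \<in> sf ?J"
    proof (rule ccontr)
      assume "1 \<notin> sf ?J"
      with J obtain M where M: "quasi_maximal st M" "?J \<subseteq> M"
        by (rule exists_quasi_maximal)
      then have "x \<in> localize M E"
        using loc by simp
      then obtain s where "s \<in> base_ring" "s \<notin> M" "s * x \<in> E"
        by (rule localizeE)
      with M(2) show False
        by auto
    qed
    then show ?thesis
      using False by (rule mem_sf_of_one_mem) (simp add: mult.commute)
  qed
qed

lemma mem_st_base_ring_iff:
  "x \<in> st base_ring \<longleftrightarrow> (\<forall>M. quasi_maximal st M \<longrightarrow> x \<in> localize M base_ring)"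
  using mem_sf_iff[OF base_ring_submodule] by (simp add: sf_base_ring)

lemma localize_sf:
  assumes "quasi_maximal st M" "E \<in> submodules"
  shows "localize M (sf E) = localize M E"
proof
  show "localize M (sf E) \<subseteq> localize M E"
    using assms by (intro localize_subset quasi_maximal_prime sf_subset_localize)
  show "localize M E \<subseteq> localize M (sf E)"
    using assms by (intro localize_mono sf_superset)
qed

lemma sf_eq_iff:
  assumes "E \<in> submodules" "F \<in> submodules"
  shows "sf E = sf F \<longleftrightarrow> (\<forall>M. quasi_maximal st M \<longrightarrow> localize M E = localize M F)"
proof
  assume "sf E = sf F"
  then show "\<forall>M. quasi_maximal st M \<longrightarrow> localize M E = localize M F"
    using localize_sf assms by metis
next
  assume "\<forall>M. quasi_maximal st M \<longrightarrow> localize M E = localize M F"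
  then show "sf E = sf F"
    using mem_sf_iff assms by auto
qed

text \<open>If x/e were in D_M, then x = (x/e)e would be in E D_M. So x/e is outside the valuation
  ring and its inverse is a nonunit.\<close>

lemma quotient_mem_localize_self:
  assumes M: "quasi_maximal st M" and E: "frac.subspace E"
    and e: "e \<in> localize M E" and x: "x \<notin> localize M E"
  shows "e * inverse x \<in> localize M M"
proof (cases "e = 0")
  case True
  note prime = quasi_maximal_prime[OF M]
  from True show ?thesis
    using prime_idealD(3)[OF prime] localize_superset[OF prime] by auto
next
  case False
  have "x * inverse e \<notin> localize M base_ring"
    using localize_scale[OF quasi_maximal_prime[OF M] E _ e, of "x * inverse e"] x False by (auto simp: mult.assoc)
  from localize_valuation[OF M this] show ?thesis
    by (simp add: mult.commute)
qed

text \<open>Given x in Q - P, each e in P satisfies e/x in D_M, so e = (e/x)x is in Q D_M, which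
  contracts to Q.\<close>

lemma primes_comparable:
  assumes M: "quasi_maximal st M" and P: "prime_ideal P" "P \<subseteq> M" and Q: "prime_ideal Q" "Q \<subseteq> M"
  shows "P \<subseteq> Q \<or> Q \<subseteq> P"
proof -
  note prime = quasi_maximal_prime[OF M]
  have "P \<subseteq> Q" if x: "x \<in> Q" "x \<notin> P" for x
  proof
    fix e
    assume e: "e \<in> P"
    have "x \<noteq> 0"
      using x(2) prime_idealD(3)[OF P(1)] by auto
    have "x \<in> base_ring"
      using x(1) prime_idealD(2)[OF Q(1)] by auto
    then have "x \<notin> localize M P"
      using x(2) localize_prime_Int[OF prime P] by auto
    moreover have "e \<in> localize M P"
      using e localize_superset[OF prime] by auto
    ultimately have "e * inverse x \<in> localize M base_ring"
      using quotient_mem_localize_self[OF M prime_idealD(1)[OF P(1)]] localize_self_subset[OF prime]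
      by blast
    moreover have "x \<in> localize M Q"
      using x(1) localize_superset[OF prime] by auto
    ultimately have "e * inverse x * x \<in> localize M Q"
      by (rule localize_scale[OF prime prime_idealD(1)[OF Q(1)]])
    moreover have "e \<in> base_ring"
      using e prime_idealD(2)[OF P(1)] by auto
    ultimately show "e \<in> Q"
      using \<open>x \<noteq> 0\<close> localize_prime_Int[OF prime Q] by (auto simp: mult.assoc)
  qed
  then show ?thesis
    by auto
qed

end

section \<open>Idempotent quasi-ideals\<close>

definition component :: "'d::idom fract set \<Rightarrow> 'd fract set \<Rightarrow> 'd fract set" where
  "component M I = localize M I \<inter> base_ring"

lemma component_prime_eq:
  assumes "prime_ideal M" "prime_ideal P" "P \<subseteq> M"
  shows "component M P = P"
  unfolding component_def using assms by (rule localize_prime_Int)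

context pstar_md
begin

text \<open>Ideals M not containing I are left out because their component would be D. For I = D the
  set is empty, matching the empty product.\<close>

definition components :: "'d fract set \<Rightarrow> 'd fract set set" where
  "components I = (\<lambda>M. component M I) ` {M. quasi_maximal st M \<and> I \<subseteq> M}"

lemma mem_components:
  "P \<in> components I \<longleftrightarrow> (\<exists>M. quasi_maximal st M \<and> I \<subseteq> M \<and> P = component M I)"
  by (auto simp: components_def)

text \<open>An element of \<open>sf I\<close> has at each M a multiple sx in I with s outside M, and
  such an s can be cancelled in D_M. Hence the dual of the closure can be tested on I
  itself.\<close>

lemma mem_colon_sf:
  assumes "I \<in> submodules"
  shows "u \<in> colon (st base_ring) (sf I) \<longleftrightarrow>
    (\<forall>M. quasi_maximal st M \<longrightarrow> (\<forall>x\<in>I. u * x \<in> localize M base_ring))"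
proof
  assume "u \<in> colon (st base_ring) (sf I)"
  then show "\<forall>M. quasi_maximal st M \<longrightarrow> (\<forall>x\<in>I. u * x \<in> localize M base_ring)"
    using sf_superset[OF assms] mem_st_base_ring_iff by (auto simp: colon_def)
next
  assume loc: "\<forall>M. quasi_maximal st M \<longrightarrow> (\<forall>x\<in>I. u * x \<in> localize M base_ring)"
  show "u \<in> colon (st base_ring) (sf I)"
    unfolding colon_def mem_st_base_ring_iff
  proof (intro CollectI ballI allI impI)
    fix x M
    assume x: "x \<in> sf I" and M: "quasi_maximal st M"
    then have "x \<in> localize M I"
      using sf_subset_localize by auto
    then obtain s where s: "s \<in> base_ring" "s \<notin> M" "s * x \<in> I"
      by (rule localizeE)
    then have "s * (u * x) \<in> localize M base_ring"
      using loc M by (metis mult.left_commute)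
    with s(1,2) show "u * x \<in> localize M base_ring"
      by (rule localize_cancel[OF quasi_maximal_prime[OF M]])
  qed
qed

section \<open>Star-products and idempotence tested locally\<close>

lemma star_product_iff:
  assumes "nonzero_ideal I" "\<And>P. P \<in> set Ps \<Longrightarrow> nonzero_ideal P"
  shows "is_star_product st I Ps \<longleftrightarrow>
    (\<forall>M. quasi_maximal st M \<longrightarrow> localize M I = localize M (mod_prod_list Ps))"
  unfolding is_star_product_def
  by (rule sf_eq_iff) (use assms nonzero_ideal_mod_prod_list nonzero_idealD(2) in blast)+

lemma star_idempotent_iff:
  assumes "nonzero_ideal I"
  shows "star_idempotent st I \<longleftrightarrow>
    (\<forall>M. quasi_maximal st M \<longrightarrow> localize M I = localize M (mod_prod I I))"
  using sf_eq_iff[of I "mod_prod I I"] nonzero_idealD(2)[OF assms]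
    nonzero_idealD(2)[OF nonzero_ideal_mod_prod[OF assms assms]] assms
  by (simp add: star_idempotent_def)

lemma star_idempotent_mod_prod:
  assumes I: "star_idempotent st I" and J: "star_idempotent st J"
  shows "star_idempotent st (mod_prod I J)"
proof -
  have nz: "nonzero_ideal I" "nonzero_ideal J"
    using I J by (simp_all add: star_idempotent_def)
  have "localize M (mod_prod I J) = localize M (mod_prod (mod_prod I J) (mod_prod I J))"
    if M: "quasi_maximal st M" for M
  proof -
    have "localize M (mod_prod I J) = localize M (mod_prod (mod_prod I I) (mod_prod J J))"
      using I J M star_idempotent_iff[OF nz(1)] star_idempotent_iff[OF nz(2)]
      by (intro localize_mod_prod_cong quasi_maximal_prime) auto
    also have "mod_prod (mod_prod I I) (mod_prod J J) = mod_prod (mod_prod I J) (mod_prod I J)"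
      using mod_prod_interchange by (rule subset_antisym) (rule mod_prod_interchange)
    finally show ?thesis .
  qed
  then show ?thesis
    using star_idempotent_iff[OF nonzero_ideal_mod_prod[OF nz]] by simp
qed

lemma star_idempotent_mod_prod_list:
  "(\<And>P. P \<in> set Ps \<Longrightarrow> star_idempotent st P) \<Longrightarrow> star_idempotent st (mod_prod_list Ps)"
proof (induction Ps)
  case Nil
  then show ?case
    by (simp add: mod_prod_list_def star_idempotent_def nonzero_ideal_base_ring
        mod_prod_base_ring subspace_base_ring)
next
  case (Cons P Ps)
  then show ?case
    using star_idempotent_mod_prod[of P "mod_prod_list Ps"] by (simp add: mod_prod_list_def)
qed

lemma star_product_of_idempotents:
  assumes I: "nonzero_ideal I" and Ps: "\<And>P. P \<in> set Ps \<Longrightarrow> star_idempotent st P"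
    and prod: "is_star_product st I Ps"
  shows "star_idempotent st I"
proof -
  let ?R = "mod_prod_list Ps"
  have nz: "nonzero_ideal P" if "P \<in> set Ps" for P
    using Ps[OF that] by (simp add: star_idempotent_def)
  have R: "star_idempotent st ?R"
    using Ps by (rule star_idempotent_mod_prod_list)
  have "localize M I = localize M (mod_prod I I)" if M: "quasi_maximal st M" for M
  proof -
    have IR: "localize M I = localize M ?R"
      using prod M by (simp add: star_product_iff[OF I nz])
    also have "\<dots> = localize M (mod_prod ?R ?R)"
      using R M star_idempotent_iff[OF nonzero_ideal_mod_prod_list[OF nz]] by simp
    also have "\<dots> = localize M (mod_prod I I)"
      using IR by (intro localize_mod_prod_cong quasi_maximal_prime M) auto
    finally show ?thesis .
  qed
  then show ?thesis
    using star_idempotent_iff[OF I] by simp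
qed

text \<open>
  If \<open>x\<close> and \<open>y\<close> lie in \<open>I\<close> but \<open>a\<close> and \<open>b\<close> do not lie in the localization of \<open>I\<close>, then both
  \<open>x / a\<close> and \<open>y / b\<close> are nonunits of the valuation ring, so \<open>a * b\<close> cannot lie in the
  localization of \<open>I\<^sup>2\<close>.
\<close>

lemma prime_component:
  assumes M: "quasi_maximal st M" and I: "nonzero_ideal I" "I \<subseteq> M"
    and idem: "localize M I = localize M (mod_prod I I)"
  shows "prime_ideal (component M I)"
proof -
  note prime = quasi_maximal_prime[OF M]
  have sub: "frac.subspace I"
    using I(1) by (rule nonzero_idealD)
  have cM: "component M I \<subseteq> M"
    unfolding component_def using localize_mono[OF I(2)] localize_self_Int[OF prime] by blast
  have "a \<in> component M I \<or> b \<in> component M I"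
    if ab: "a \<in> base_ring" "b \<in> base_ring" "a * b \<in> component M I" for a b
  proof (rule ccontr)
    assume "\<not> (a \<in> component M I \<or> b \<in> component M I)"
    then have n: "a \<notin> localize M I" "b \<notin> localize M I"
      using ab by (auto simp: component_def)
    then have nz: "a \<noteq> 0" "b \<noteq> 0"
      using subspaceD(1)[OF subspace_localize[OF prime sub]] by auto
    have mm: "frac.subspace (localize M M)"
      by (rule subspace_localize[OF prime prime_idealD(1)[OF prime]])
    have "mod_prod I I \<subseteq> {z. z * inverse (a * b) \<in> localize M M}"
    proof (rule mod_prod_subset[OF subspace_vimage_mult[OF mm]])
      fix x y
      assume "x \<in> I" "y \<in> I"
      then have "x \<in> localize M I" "y \<in> localize M I"
        using localize_superset[OF prime] by auto
      then have "x * inverse a \<in> localize M M" "y * inverse b \<in> localize M M"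
        using n by (auto intro: quotient_mem_localize_self[OF M sub])
      then have "(x * inverse a) * (y * inverse b) \<in> localize M M"
        using localize_self_subset[OF prime]
        by (intro localize_scale[OF prime prime_idealD(1)[OF prime], of "x * inverse a"]) auto
      then show "x * y \<in> {z. z * inverse (a * b) \<in> localize M M}"
        by (simp add: mult_ac)
    qed
    moreover have "a * b \<in> localize M (mod_prod I I)"
      using ab(3) idem by (simp add: component_def)
    then obtain s where s: "s \<in> base_ring" "s \<notin> M" "s * (a * b) \<in> mod_prod I I"
      by (rule localizeE)
    ultimately have "s * (a * b) * inverse (a * b) \<in> localize M M"
      by auto
    moreover have "s * (a * b) * inverse (a * b) = s"
      using nz by (simp add: field_simps)
    ultimately have "s \<in> localize M M"
      by (simp only:)
    with s(1,2) localize_self_Int[OF prime] show False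
      by auto
  qed
  moreover have "frac.subspace (component M I)"
    unfolding component_def
    by (intro frac.subspace_inter subspace_localize prime sub subspace_base_ring)
  moreover have "component M I \<subset> base_ring"
    using cM prime_idealD(2,4)[OF prime] base_ring_closed(2) by blast
  ultimately show ?thesis
    unfolding prime_ideal_def by blast
qed

lemma localize_of_not_subset:
  assumes "quasi_maximal st M" "nonzero_ideal I" "\<not> I \<subseteq> M"
  shows "localize M I = localize M base_ring"
  using assms by (intro localize_not_subset quasi_maximal_prime nonzero_idealD)

lemma localize_base_ring_neq:
  assumes M: "quasi_maximal st M" and I: "I \<subseteq> M"
  shows "localize M I \<noteq> localize M base_ring"
proof
  assume "localize M I = localize M base_ring"
  then have "1 \<in> localize M I"
    using localize_superset[OF quasi_maximal_prime[OF M]] base_ring_closed(2) by blast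
  then obtain s where "s \<in> base_ring" "s \<notin> M" "s * 1 \<in> I"
    by (rule localizeE)
  with I show False
    by auto
qed

lemma quasi_prime_below:
  assumes "quasi_prime st Q"
  obtains M where "quasi_maximal st M" "Q \<subseteq> M"
proof (rule exists_quasi_maximal)
  show "nonzero_ideal Q"
    using assms by (simp add: quasi_prime_def quasi_ideal_def)
  have "Q = sf Q \<inter> base_ring" "prime_ideal Q"
    using assms by (simp_all add: quasi_prime_def quasi_ideal_def)
  then show "1 \<notin> sf Q"
    using prime_idealD(4) base_ring_closed(2) by blast
qed

lemma incomparable_distinct:
  assumes "incomparable Ps"
  shows "distinct Ps"
  using assms unfolding incomparable_def distinct_conv_nth by (metis subset_refl)

lemma incomparable_eq:
  assumes "incomparable Ps" "P \<in> set Ps" "Q \<in> set Ps" "P \<subseteq> Q"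
  shows "P = Q"
  using assms unfolding incomparable_def in_set_conv_nth by metis

text \<open>This is the source of uniqueness: the right-hand side depends on I alone. At most one
  factor Q lies below a given M, and then I D_M = Q D_M contracts to Q.\<close>

lemma incomparable_factors:
  assumes I: "nonzero_ideal I" and inc: "incomparable Ps"
    and Ps: "\<And>P. P \<in> set Ps \<Longrightarrow> quasi_prime st P" and prod: "is_star_product st I Ps"
  shows "set Ps = components I"
proof -
  have nz: "nonzero_ideal P" and pr: "prime_ideal P" if "P \<in> set Ps" for P
    using Ps[OF that] by (simp_all add: quasi_prime_def quasi_ideal_def)
  have loc: "localize M I = localize M (mod_prod_list Ps)" if "quasi_maximal st M" for M
    using prod that by (simp add: star_product_iff[OF I nz])
  have *: "I \<subseteq> M \<and> component M I = Q" if Q: "Q \<in> set Ps" "Q \<subseteq> M" and M: "quasi_maximal st M" for Q M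
  proof -
    note prime = quasi_maximal_prime[OF M]
    have "P = Q" if "P \<in> set Ps" "P \<subseteq> M" for P
      using primes_comparable[OF M pr[OF that(1)] that(2) pr[OF Q(1)] Q(2)]
        incomparable_eq[OF inc that(1) Q(1)] incomparable_eq[OF inc Q(1) that(1)] by auto
    then have "localize M I = localize M Q"
      unfolding loc[OF M]
      using localize_mod_prod_list_single[OF prime nz incomparable_distinct[OF inc] Q] by simp
    then have c: "component M I = Q"
      using component_prime_eq[OF prime pr[OF Q(1)] Q(2)] by (simp add: component_def)
    moreover have "I \<subseteq> component M I"
      using nonzero_idealD(3)[OF I] localize_superset[OF prime] by (simp add: component_def)
    ultimately show ?thesis
      using Q(2) by auto
  qed
  show ?thesis
  proof
    show "set Ps \<subseteq> components I"
    proof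
      fix Q
      assume Q: "Q \<in> set Ps"
      obtain M where M: "quasi_maximal st M" "Q \<subseteq> M"
        by (rule quasi_prime_below[OF Ps[OF Q]])
      then show "Q \<in> components I"
        using *[OF Q M(2,1)] by (auto simp: mem_components)
    qed
    show "components I \<subseteq> set Ps"
    proof
      fix P
      assume "P \<in> components I"
      then obtain M where M: "quasi_maximal st M" "I \<subseteq> M" and P: "P = component M I"
        by (auto simp: mem_components)
      have "\<exists>Q\<in>set Ps. Q \<subseteq> M"
      proof (rule ccontr)
        assume "\<not> (\<exists>Q\<in>set Ps. Q \<subseteq> M)"
        then have "localize M (mod_prod_list Ps) = localize M base_ring"
          by (intro localize_mod_prod_list_none quasi_maximal_prime M nz) auto
        then show False
          using localize_base_ring_neq[OF M] loc[OF M(1)] by simp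
      qed
      then show "P \<in> set Ps"
        using * M(1) P by auto
    qed
  qed
qed

end

section \<open>The components of a fixed idempotent quasi-ideal\<close>

locale idempotent_quasi_ideal = pstar_md st
  for st :: "'d::idom fract set \<Rightarrow> 'd fract set" +
  fixes I :: "'d fract set"
  assumes quasi: "quasi_ideal st I" and idem: "star_idempotent st I"
begin

lemma nz: "nonzero_ideal I"
  using quasi by (simp add: quasi_ideal_def)

lemma sub: "I \<in> submodules" "frac.subspace I" "I \<subseteq> base_ring"
  using nz by (simp_all add: nonzero_idealD)

lemma localize_square: "quasi_maximal st M \<Longrightarrow> localize M (mod_prod I I) = localize M I"
  using idem star_idempotent_iff[OF nz] by simp

context
  fixes M
  assumes M: "quasi_maximal st M" "I \<subseteq> M"
begin

lemma component_prime: "prime_ideal (component M I)"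
  using M nz localize_square by (intro prime_component) auto

lemma component_superset: "I \<subseteq> component M I"
  using sub(3) localize_superset[OF quasi_maximal_prime[OF M(1)]] by (simp add: component_def)

lemma component_subset: "component M I \<subseteq> M"
  unfolding component_def
  using localize_mono[OF M(2), of M] localize_self_Int[OF quasi_maximal_prime[OF M(1)]] by blast

lemma localize_component: "localize M (component M I) = localize M I"
proof
  show "localize M (component M I) \<subseteq> localize M I"
    by (intro localize_subset quasi_maximal_prime M) (simp add: component_def)
  show "localize M I \<subseteq> localize M (component M I)"
    by (rule localize_mono[OF component_superset])
qed

lemma nonzero_component: "nonzero_ideal (component M I)"
proof -
  obtain x where "x \<in> I" "x \<noteq> 0"
    using sub(1) by (rule submodule_has_nonzero)
  then have "component M I \<in> submodules"
    using component_superset prime_idealD(1)[OF component_prime] by (intro submoduleI[of _ x]) auto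
  then show ?thesis
    by (simp add: nonzero_ideal_def component_def)
qed

end

text \<open>If sx is in I with s outside N, then s is also outside the prime
  \<open>component M I\<close>, while sx is in it. Primality leaves only x.\<close>

lemma component_antimono:
  assumes M: "quasi_maximal st M" "I \<subseteq> M" and N: "quasi_maximal st N" "component M I \<subseteq> N"
  shows "component N I \<subseteq> component M I"
proof
  fix x
  assume x: "x \<in> component N I"
  then obtain s where s: "s \<in> base_ring" "s \<notin> N" "s * x \<in> I"
    by (auto simp: component_def elim: localizeE)
  have "x \<in> base_ring"
    using x by (simp add: component_def)
  moreover have "s * x \<in> component M I" "s \<notin> component M I"
    using s component_superset[OF M] N(2) by auto
  ultimately show "x \<in> component M I"
    using prime_idealD(5)[OF component_prime[OF M] s(1)] by auto
qed

text \<open>The first inclusion places \<open>component N I\<close> inside M, which is exactly the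
  condition for \<open>component_antimono\<close> with M and N exchanged.\<close>

lemma component_eq:
  assumes M: "quasi_maximal st M" "I \<subseteq> M" and N: "quasi_maximal st N" "component M I \<subseteq> N"
  shows "component N I = component M I"
proof -
  have IN: "I \<subseteq> N"
    using component_superset[OF M] N(2) by blast
  have 1: "component N I \<subseteq> component M I"
    using M N by (rule component_antimono)
  then have "component N I \<subseteq> M"
    using component_subset[OF M] by blast
  with 1 show ?thesis
    using component_antimono[OF N(1) IN M(1)] by blast
qed

lemma quasi_prime_component:
  assumes M: "quasi_maximal st M" "I \<subseteq> M"
  shows "quasi_prime st (component M I)"
proof -
  let ?P = "component M I"
  have "sf ?P \<inter> base_ring \<subseteq> ?P"
    using sf_subset_localize[OF M(1), of ?P] localize_component[OF M] by (auto simp: component_def)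
  moreover have "?P \<subseteq> sf ?P \<inter> base_ring"
    using sf_superset[OF nonzero_idealD(2)] nonzero_idealD(3) nonzero_component[OF M] by simp
  ultimately show ?thesis
    using component_prime[OF M] nonzero_component[OF M]
    by (simp add: quasi_prime_def quasi_ideal_def subset_antisym)
qed

text \<open>Let P be the component. At N above P the localizations of P and I agree, so idempotence
  is inherited from I; at any other N neither P nor its square lies in N, and both localize to
  D_N.\<close>

lemma star_idempotent_component:
  assumes M: "quasi_maximal st M" "I \<subseteq> M"
  shows "star_idempotent st (component M I)"
proof -
  let ?P = "component M I"
  have P: "nonzero_ideal ?P"
    using M by (rule nonzero_component)
  have "localize N ?P = localize N (mod_prod ?P ?P)" if N: "quasi_maximal st N" for N
  proof (cases "?P \<subseteq> N")
    case True
    then have IN: "I \<subseteq> N"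
      using component_superset[OF M] by blast
    have "localize N ?P = localize N I"
      using component_eq[OF M N True] localize_component[OF N IN] by simp
    then show ?thesis
      using localize_mod_prod_cong[of N ?P I ?P I] quasi_maximal_prime[OF N] localize_square[OF N]
      by simp
  next
    case False
    then have "\<not> mod_prod ?P ?P \<subseteq> N"
      using P quasi_maximal_prime[OF N]
      by (intro mod_prod_not_subset_prime nonzero_idealD(3))
    then show ?thesis
      using False N P nonzero_ideal_mod_prod[OF P P] by (simp add: localize_of_not_subset)
  qed
  then show ?thesis
    using star_idempotent_iff[OF P] by simp
qed

text \<open>By \<open>component_eq\<close> a component contained in M is the component at M. So
  exactly one factor survives localization at M when I is contained in M, and none
  otherwise.\<close>

lemma component_product:
  assumes Ps: "distinct Ps" "set Ps = components I"
  shows "is_star_product st I Ps"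
proof -
  have comp: "\<exists>N. quasi_maximal st N \<and> I \<subseteq> N \<and> P = component N I" if "P \<in> set Ps" for P
    using that Ps(2) by (simp add: mem_components)
  have nzP: "nonzero_ideal P" if P: "P \<in> set Ps" for P
  proof -
    obtain N where N: "quasi_maximal st N" "I \<subseteq> N" "P = component N I"
      using comp[OF P] by auto
    then show ?thesis
      using nonzero_component[OF N(1,2)] by simp
  qed
  have "localize M I = localize M (mod_prod_list Ps)" if M: "quasi_maximal st M" for M
  proof (cases "I \<subseteq> M")
    case True
    have uniq: "P = component M I" if P: "P \<in> set Ps" "P \<subseteq> M" for P
    proof -
      obtain N where N: "quasi_maximal st N" "I \<subseteq> N" "P = component N I"
        using comp[OF P(1)] by auto
      then show ?thesis
        using component_eq[OF N(1,2) M] P(2) by simp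
    qed
    have "component M I \<in> components I"
      unfolding components_def using M True by (intro imageI) simp
    then have "component M I \<in> set Ps"
      using Ps(2) by simp
    then have "localize M (mod_prod_list Ps) = localize M (component M I)"
      by (intro localize_mod_prod_list_single quasi_maximal_prime M nzP Ps(1)
          component_subset True uniq)
    then show ?thesis
      using localize_component[OF M True] by simp
  next
    case False
    have "\<not> P \<subseteq> M" if P: "P \<in> set Ps" for P
    proof -
      obtain N where N: "quasi_maximal st N" "I \<subseteq> N" "P = component N I"
        using comp[OF P] by auto
      then show ?thesis
        using component_superset[OF N(1,2)] False by auto
    qed
    then have "localize M (mod_prod_list Ps) = localize M base_ring"
      by (intro localize_mod_prod_list_none quasi_maximal_prime M nzP)
    then show ?thesis
      using localize_of_not_subset[OF M nz False] by simp
  qed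
  then show ?thesis
    using star_product_iff[OF nz nzP] by simp
qed

lemma incomparable_components:
  assumes Ps: "distinct Ps" "set Ps = components I"
  shows "incomparable Ps"
  unfolding incomparable_def
proof (intro allI impI notI)
  fix i j
  assume ij: "i < length Ps" "j < length Ps" "i \<noteq> j" "Ps ! i \<subseteq> Ps ! j"
  then have "Ps ! i \<in> components I" "Ps ! j \<in> components I"
    using Ps(2) nth_mem by auto
  then obtain M N where M: "quasi_maximal st M" "I \<subseteq> M" "Ps ! i = component M I"
    and N: "quasi_maximal st N" "I \<subseteq> N" "Ps ! j = component N I"
    by (auto simp: mem_components)
  have "component N I = component M I"
    using M N ij(4) component_subset[OF N(1,2)] by (intro component_eq) auto
  then show False
    using M(3) N(3) ij nth_eq_iff_index_eq[OF Ps(1), of i j] by simp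
qed

end

section \<open>Divisoriality\<close>

context idempotent_quasi_ideal
begin

text \<open>Here I D_M = M D_M is idempotent. If u were outside D_M, then 1/u would be in I^2 D_M,
  say s/u in I^2 with s outside M. But u I^2 = (uI)I is contained in M D_M, so s would be in
  M.\<close>

lemma colon_localize_self_subset:
  assumes M: "quasi_maximal st M" "I \<subseteq> M" "component M I = M"
    and u: "\<And>x. x \<in> I \<Longrightarrow> u * x \<in> localize M base_ring"
  shows "u \<in> localize M base_ring"
proof (rule ccontr)
  note prime = quasi_maximal_prime[OF M(1)]
  assume nu: "u \<notin> localize M base_ring"
  then have "u \<noteq> 0"
    using subspaceD(1)[OF subspace_localize[OF prime subspace_base_ring]] by auto
  have "inverse u \<in> localize M M"
    using M(1) nu by (rule localize_valuation)
  then have "inverse u \<in> localize M (mod_prod I I)"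
    using localize_component[OF M(1,2)] localize_square[OF M(1)] M(3) by simp
  then obtain s where s: "s \<in> base_ring" "s \<notin> M" "s * inverse u \<in> mod_prod I I"
    by (rule localizeE)
  have "mod_prod I I \<subseteq> {z. z * u \<in> localize M M}"
  proof (rule mod_prod_subset)
    show "frac.subspace {z. z * u \<in> localize M M}"
      by (intro subspace_vimage_mult subspace_localize prime prime_idealD(1)[OF prime])
    fix x y
    assume x: "x \<in> I" and "y \<in> I"
    then have "y \<in> localize M M"
      using M(2) localize_superset[OF prime] by auto
    with u[OF x] have "(u * x) * y \<in> localize M M"
      by (rule localize_scale[OF prime prime_idealD(1)[OF prime]])
    then show "x * y \<in> {z. z * u \<in> localize M M}"
      by (simp add: mult_ac)
  qed
  with s(3) have "s * inverse u * u \<in> localize M M"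
    by auto
  moreover have "s * inverse u * u = s"
    using \<open>u \<noteq> 0\<close> by (simp add: mult.assoc)
  ultimately have "s \<in> localize M M"
    by (simp only:)
  with s(1,2) localize_self_Int[OF prime] show False
    by auto
qed

lemma finite_quasi_maximal_above:
  assumes "finite_star_character st"
  shows "finite {M. quasi_maximal st M \<and> I \<subseteq> M}"
proof -
  obtain x where x: "x \<in> I" "x \<noteq> 0"
    using sub(1) by (rule submodule_has_nonzero)
  then have "finite {M. quasi_maximal st M \<and> x \<in> M}"
    using assms sub(3) by (auto simp: finite_star_character_def)
  then show ?thesis
    by (rule finite_subset[rotated]) (use x in auto)
qed

text \<open>
  If the component at \<open>M\<close> is \<open>M\<close> itself, then removing this component from the product does not
  change \<open>(D\<^sup>\<star> : I)\<close>; the element \<open>d\<close> below lies in all other components but not in \<open>M\<close>.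
\<close>

lemma component_neq_of_star_divisorial:
  assumes fin: "finite_star_character st" and div: "star_divisorial st I"
    and M: "quasi_maximal st M" "I \<subseteq> M"
  shows "component M I \<noteq> M"
proof
  note prime = quasi_maximal_prime[OF M(1)]
  assume eq: "component M I = M"
  let ?R = "st base_ring"
  let ?N = "{N. quasi_maximal st N \<and> I \<subseteq> N} - {M}"
  \<comment> \<open>Otherwise the components at M and N would coincide, giving M contained in N and
    hence M = N.\<close>
  have nsub: "\<not> localize N I \<inter> base_ring \<subseteq> M"
    if N: "quasi_maximal st N" "I \<subseteq> N" "N \<noteq> M" for N
  proof
    assume "localize N I \<inter> base_ring \<subseteq> M"
    then have "component M I = component N I"
      using component_eq[OF N(1,2) M(1)] by (simp add: component_def)
    then have "M \<subseteq> N"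
      using eq component_subset[OF N(1,2)] by simp
    then show False
      using quasi_maximal_eq[OF M(1) N(1)] N(3) by simp
  qed
  have "\<exists>d\<in>base_ring - M. \<forall>A\<in>(\<lambda>N. localize N I) ` ?N. d \<in> A"
  proof (rule finite_Inter_not_subset_prime[OF prime])
    show "finite ((\<lambda>N. localize N I) ` ?N)"
      using finite_quasi_maximal_above[OF fin] by simp
    fix A
    assume "A \<in> (\<lambda>N. localize N I) ` ?N"
    then obtain N where N: "quasi_maximal st N" "I \<subseteq> N" "N \<noteq> M" and A: "A = localize N I"
      by auto
    show "frac.subspace A \<and> \<not> A \<inter> base_ring \<subseteq> M"
      unfolding A using nsub[OF N] subspace_localize[OF quasi_maximal_prime[OF N(1)] sub(2)] by simp
  qed
  then obtain d where d: "d \<in> base_ring" "d \<notin> M" "\<forall>N\<in>?N. d \<in> localize N I"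
    by auto
  have "d * u \<in> ?R" if "u \<in> colon ?R (sf I)" for u
    unfolding mem_st_base_ring_iff
  proof (intro allI impI)
    fix N
    assume N: "quasi_maximal st N"
    note primeN = quasi_maximal_prime[OF N]
    have u: "u * x \<in> localize N base_ring" if "x \<in> I" for x
      using \<open>u \<in> colon ?R (sf I)\<close> N that unfolding mem_colon_sf[OF sub(1)] by blast
    have scale: "d * u \<in> localize N base_ring" if "u \<in> localize N base_ring"
      using that d(1) localize_superset[OF primeN, of base_ring]
      by (intro localize_scale[OF primeN subspace_base_ring]) auto
    \<comment> \<open>At M the local dual of I is D_M; at another N above I, d was chosen in I D_N;
      at the remaining N some element of I is a unit of D_N, so u is already in D_N.\<close>
    consider "N = M" | "N \<noteq> M" "I \<subseteq> N" | "\<not> I \<subseteq> N"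
      by blast
    then show "d * u \<in> localize N base_ring"
    proof cases
      case 1
      then show ?thesis
        using colon_localize_self_subset[OF M eq] u scale by simp
    next
      case 2
      then have "d \<in> localize N I"
        using d(3) N by simp
      then obtain s where s: "s \<in> base_ring" "s \<notin> N" "s * d \<in> I"
        by (rule localizeE)
      then have "s * (d * u) \<in> localize N base_ring"
        using u[of "s * d"] by (simp add: mult_ac)
      with s(1,2) show ?thesis
        by (rule localize_cancel[OF primeN])
    next
      case 3
      then obtain x where x: "x \<in> I" "x \<notin> N"
        by auto
      then have "x * u \<in> localize N base_ring"
        using u[of x] by (simp add: mult.commute)
      with subsetD[OF sub(3) x(1)] x(2) have "u \<in> localize N base_ring"
        by (rule localize_cancel[OF primeN])
      then show ?thesis
        by (rule scale)
    qed
  qed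
  then have "d \<in> colon ?R (colon ?R (sf I))"
    by (simp add: colon_def)
  moreover have "sf I = colon ?R (colon ?R (sf I))"
    using div unfolding star_divisorial_def by (rule conjunct2)
  ultimately have "d \<in> sf I"
    by (rule ssubst[rotated])
  then have "d \<in> component M I"
    using sf_subset_localize[OF M(1)] d(1) by (auto simp: component_def)
  with d(2) eq show False
    by simp
qed

text \<open>
  Let \<open>P\<close> be the component at \<open>M\<close>. An element \<open>y \<in> D\<close> outside \<open>P\<close> divides every element of \<open>P\<close>
  in the localization at \<open>M\<close>. Choosing \<open>p \<in> P\<close> outside a quasi-maximal ideal \<open>N\<close>, the
  denominator of \<open>p / y\<close> becomes divisible by \<open>y\<close> in the localization at \<open>N\<close>.
\<close>

lemma denominator_not_subset:
  assumes M: "quasi_maximal st M" "I \<subseteq> M" and N: "\<not> component M I \<subseteq> N"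
    and y: "y \<in> base_ring" "y \<notin> component M I"
  shows "\<not> {z. z * inverse y \<in> localize N base_ring} \<inter> base_ring \<subseteq> M"
proof -
  note prime = quasi_maximal_prime[OF M(1)]
  obtain p where p: "p \<in> localize M I" "p \<in> base_ring" "p \<notin> N"
    using N by (auto simp: component_def)
  have "y \<notin> localize M I"
    using y by (simp add: component_def)
  then have "p * inverse y \<in> localize M base_ring"
    using quotient_mem_localize_self[OF M(1) sub(2) p(1)] localize_self_subset[OF prime] by auto
  then obtain m where m: "m \<in> base_ring" "m \<notin> M" "m * (p * inverse y) \<in> base_ring"
    by (rule localizeE)
  then have "m * inverse y \<in> localize N base_ring"
    using p by (intro localizeI[of p]) (auto simp: mult_ac)
  with m show ?thesis
    by auto
qed

text \<open>Let P be the component at M. For N not containing y, 1/y is in D_N; for N above P, y is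
  outside I D_N, so I/y is contained in D_N. The remaining N contain the nonzero y, so they are
  finitely many, and d clears 1/y at each of them.\<close>

lemma exists_colon_multiplier:
  assumes fin: "finite_star_character st" and M: "quasi_maximal st M" "I \<subseteq> M"
    and y: "y \<in> base_ring" "y \<notin> component M I"
  obtains d where "d \<in> base_ring" "d \<notin> M" "d * inverse y \<in> colon (st base_ring) (sf I)"
proof -
  note prime = quasi_maximal_prime[OF M(1)]
  let ?P = "component M I"
  let ?A = "\<lambda>N. {z. z * inverse y \<in> localize N base_ring}"
  let ?N = "{N. quasi_maximal st N \<and> y \<in> N \<and> \<not> ?P \<subseteq> N}"
  have "y \<noteq> 0"
    using y(2) prime_idealD(3)[OF component_prime[OF M]] by auto
  then have "finite {N. quasi_maximal st N \<and> y \<in> N}"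
    using fin y(1) by (simp add: finite_star_character_def)
  then have finN: "finite ?N"
    by (rule finite_subset[rotated]) auto
  have "\<exists>d\<in>base_ring - M. \<forall>A\<in>?A ` ?N. d \<in> A"
  proof (rule finite_Inter_not_subset_prime[OF prime])
    show "finite (?A ` ?N)"
      using finN by simp
    fix A
    assume "A \<in> ?A ` ?N"
    then obtain N where N: "quasi_maximal st N" "\<not> ?P \<subseteq> N" and A: "A = ?A N"
      by auto
    have "frac.subspace (?A N)"
      by (intro subspace_vimage_mult subspace_localize quasi_maximal_prime N subspace_base_ring)
    then show "frac.subspace A \<and> \<not> A \<inter> base_ring \<subseteq> M"
      unfolding A using denominator_not_subset[OF M N(2) y] by simp
  qed
  then obtain d where d: "d \<in> base_ring" "d \<notin> M" "\<forall>N\<in>?N. d \<in> ?A N"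
    by auto
  have "d * inverse y * e \<in> localize N base_ring" if N: "quasi_maximal st N" and e: "e \<in> I" for N e
  proof -
    note primeN = quasi_maximal_prime[OF N]
    have eD: "e \<in> base_ring"
      using e sub(3) by auto
    consider "y \<notin> N" | "y \<in> N" "\<not> ?P \<subseteq> N" | "?P \<subseteq> N"
      by auto
    then show ?thesis
    proof cases
      case 1
      have "y * (d * inverse y * e) = d * e"
        using \<open>y \<noteq> 0\<close> by (simp add: field_simps)
      then have "y * (d * inverse y * e) \<in> base_ring"
        using d(1) eD by (simp only: base_ring_closed)
      with y(1) 1 show ?thesis
        by (rule localizeI)
    next
      case 2
      then have "N \<in> ?N"
        using N by simp
      with d(3) have "d \<in> ?A N"
        by (rule bspec)
      then have "e * (d * inverse y) \<in> localize N base_ring"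
        using subspaceD(3)[OF subspace_localize[OF primeN subspace_base_ring] eD] by simp
      then show ?thesis
        by (simp add: mult.commute)
    next
      case 3
      then have "component N I = ?P"
        by (rule component_eq[OF M N])
      then have "y \<notin> localize N I"
        using y by (auto simp: component_def)
      moreover have "e \<in> localize N I"
        using e localize_superset[OF primeN] by auto
      ultimately have "e * inverse y \<in> localize N base_ring"
        using quotient_mem_localize_self[OF N sub(2)] localize_self_subset[OF primeN] by blast
      then have "d * (e * inverse y) \<in> localize N base_ring"
        by (rule subspaceD(3)[OF subspace_localize[OF primeN subspace_base_ring] d(1)])
      then show ?thesis
        by (simp add: mult_ac)
    qed
  qed
  then have "d * inverse y \<in> colon (st base_ring) (sf I)"
    using mem_colon_sf[OF sub(1)] by simp
  with d(1,2) show ?thesis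
    by (rule that)
qed

text \<open>Suppose x is in the bidual but outside I D_M, and sx is in D with s outside M. An
  element t of M outside the component P makes y = t(sx) avoid P, so some d/y with d outside M is in
  the dual of I. Then x(d/y) = d/(ts) is in D_M although ts is in M, forcing d into M.\<close>

lemma star_divisorial_of_component_neq:
  assumes fin: "finite_star_character st"
    and neq: "\<And>M. quasi_maximal st M \<Longrightarrow> I \<subseteq> M \<Longrightarrow> component M I \<noteq> M"
  shows "star_divisorial st I"
proof -
  let ?R = "st base_ring"
  have "x \<in> sf I" if x: "x \<in> colon ?R (colon ?R (sf I))" for x
    unfolding mem_sf_iff[OF sub(1)]
  proof (intro allI impI)
    fix M
    assume M: "quasi_maximal st M"
    note prime = quasi_maximal_prime[OF M]
    have loc: "x * u \<in> localize M base_ring" if "u \<in> colon ?R (sf I)" for u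
      using x that M mem_st_base_ring_iff by (simp add: colon_def)
    \<comment> \<open>The multiplier 1 shows that x is in D_M. This settles the case of I not
      contained in M and supplies s in the other case.\<close>
    have "1 \<in> colon ?R (sf I)"
      using sub(3) localize_superset[OF quasi_maximal_prime, of _ base_ring]
      by (auto simp: mem_colon_sf[OF sub(1)])
    then have xM: "x \<in> localize M base_ring"
      using loc[of 1] by simp
    show "x \<in> localize M I"
    proof (cases "I \<subseteq> M")
      case False
      then show ?thesis
        using xM localize_of_not_subset[OF M nz] by simp
    next
      case True
      show ?thesis
      proof (rule ccontr)
        let ?P = "component M I"
        assume nx: "x \<notin> localize M I"
        obtain t where t: "t \<in> M" "t \<notin> ?P"
          using neq[OF M True] component_subset[OF M True] by auto
        obtain s where s: "s \<in> base_ring" "s \<notin> M" "s * x \<in> base_ring"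
          using xM by (rule localizeE)
        have tD: "t \<in> base_ring"
          using t(1) prime_idealD(2)[OF prime] by auto
        have "s * x \<notin> ?P"
          using nx localize_cancel[OF prime s(1,2)] by (auto simp: component_def)
        then have "t * (s * x) \<notin> ?P"
          using prime_idealD(5)[OF component_prime[OF M True] tD s(3)] t(2) by auto
        then obtain d where d: "d \<in> base_ring" "d \<notin> M"
          "d * inverse (t * (s * x)) \<in> colon ?R (sf I)"
          using exists_colon_multiplier[OF fin M True base_ring_closed(4)[OF tD s(3)]] by blast
        have "t \<noteq> 0" "s \<noteq> 0" "x \<noteq> 0"
          using t(2) s(2) nx prime_idealD(3)[OF prime] prime_idealD(3)[OF component_prime[OF M True]]
            subspaceD(1)[OF subspace_localize[OF prime sub(2)]] by auto
        then have eq: "(t * s) * (x * (d * inverse (t * (s * x)))) = d"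
          by (simp add: field_simps)
        have "t * s \<in> M"
          using subspaceD(3)[OF prime_idealD(1)[OF prime] s(1) t(1)] by (simp add: mult.commute)
        then have "t * s \<in> localize M M"
          using localize_superset[OF prime] by auto
        with loc[OF d(3)] have "x * (d * inverse (t * (s * x))) * (t * s) \<in> localize M M"
          by (rule localize_scale[OF prime prime_idealD(1)[OF prime]])
        then have "d \<in> localize M M"
          using eq by (simp only: mult.commute)
        with d(1,2) localize_self_Int[OF prime] show False
          by auto
      qed
    qed
  qed
  moreover have "x \<in> colon ?R (colon ?R (sf I))" if "x \<in> sf I" for x
    using that by (auto simp: colon_def mult.commute)
  ultimately have "sf I = colon ?R (colon ?R (sf I))"
    by blast
  with nz show ?thesis
    unfolding star_divisorial_def by (rule conjI)
qed

lemma star_divisorial_iff: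
  assumes "finite_star_character st"
  shows "star_divisorial st I \<longleftrightarrow>
    (\<forall>M. quasi_maximal st M \<longrightarrow> I \<subseteq> M \<longrightarrow> component M I \<noteq> M)"
  using component_neq_of_star_divisorial[OF assms] star_divisorial_of_component_neq[OF assms]
  by metis

end

section \<open>Divisorial primes and their products\<close>

context pstar_md
begin

text \<open>A prime is its own component at each M above it, so the criterion says that P differs
  from all those M.\<close>

lemma star_divisorial_prime_iff:
  assumes "finite_star_character st" "quasi_prime st P" "star_idempotent st P"
  shows "star_divisorial st P \<longleftrightarrow> \<not> quasi_maximal st P"
proof -
  interpret idempotent_quasi_ideal st P
    using assms by unfold_locales (simp_all add: quasi_prime_def)
  have "component M P = P" if "quasi_maximal st M" "P \<subseteq> M" for M
    using assms(2) component_prime_eq[OF quasi_maximal_prime[OF that(1)] _ that(2)]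
    by (simp add: quasi_prime_def)
  then show ?thesis
    using star_divisorial_iff[OF assms(1)] by (metis subset_refl)
qed

text \<open>Suppose the component of I at M were M. Some factor P lies below M, since otherwise the
  product would localize to D_M. As the product is contained in P, the component M is contained in
  the component of P, which is P; so P = M would be quasi-maximal.\<close>

lemma star_divisorial_of_product:
  assumes fin: "finite_star_character st" and I: "quasi_ideal st I"
    and Ps: "\<And>P. P \<in> set Ps \<Longrightarrow> quasi_prime st P \<and> star_idempotent st P \<and> \<not> quasi_maximal st P"
    and prod: "is_star_product st I Ps"
  shows "star_idempotent st I" "star_divisorial st I"
proof -
  have nzI: "nonzero_ideal I"
    using I by (simp add: quasi_ideal_def)
  have nzP: "nonzero_ideal P" if "P \<in> set Ps" for P
    using Ps[OF that] by (simp add: star_idempotent_def)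
  show idem: "star_idempotent st I"
    using nzI _ prod by (rule star_product_of_idempotents) (simp add: Ps)
  interpret idempotent_quasi_ideal st I
    using I idem by unfold_locales
  have "component M I \<noteq> M" if M: "quasi_maximal st M" "I \<subseteq> M" for M
  proof
    assume eq: "component M I = M"
    note prime = quasi_maximal_prime[OF M(1)]
    have loc: "localize M I = localize M (mod_prod_list Ps)"
      using prod M(1) star_product_iff[OF nzI nzP] by simp
    obtain P where P: "P \<in> set Ps" "P \<subseteq> M"
      using localize_mod_prod_list_none[OF prime nzP] localize_base_ring_neq[OF M] loc by metis
    have "mod_prod_list Ps \<subseteq> P"
      using P(1) nzP by (rule mod_prod_list_subset)
    then have "component M I \<subseteq> component M P"
      unfolding component_def loc by (intro Int_mono localize_mono) auto
    moreover have "component M P = P"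
      using Ps[OF P(1)] P(2) by (intro component_prime_eq prime) (simp_all add: quasi_prime_def)
    ultimately have "M = P"
      using eq P(2) by auto
    then show False
      using Ps[OF P(1)] M(1) by simp
  qed
  then show "star_divisorial st I"
    using star_divisorial_iff[OF fin] by simp
qed

end

context idempotent_quasi_ideal
begin

lemma component_factorization:
  assumes fin: "finite_star_character st"
  obtains Ps where "set Ps = components I" "distinct Ps" "is_star_product st I Ps" "incomparable Ps"
    "\<And>P. P \<in> set Ps \<Longrightarrow> quasi_prime st P \<and> star_idempotent st P"
    "star_divisorial st I \<Longrightarrow> (\<And>P. P \<in> set Ps \<Longrightarrow> \<not> quasi_maximal st P)"
proof -
  have "finite (components I)"
    unfolding components_def by (intro finite_imageI finite_quasi_maximal_above fin)
  then obtain Ps where Ps: "set Ps = components I" "distinct Ps"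
    using finite_distinct_list by blast
  have comp: "\<exists>N. quasi_maximal st N \<and> I \<subseteq> N \<and> P = component N I" if "P \<in> set Ps" for P
    using that Ps(1) by (simp add: mem_components)
  show ?thesis
  proof (rule that[OF Ps component_product[OF Ps(2,1)] incomparable_components[OF Ps(2,1)]])
    fix P
    assume "P \<in> set Ps"
    then obtain N where N: "quasi_maximal st N" "I \<subseteq> N" "P = component N I"
      using comp by blast
    then show "quasi_prime st P \<and> star_idempotent st P"
      using quasi_prime_component[OF N(1,2)] star_idempotent_component[OF N(1,2)] by simp
  next
    fix P
    assume div: "star_divisorial st I" and "P \<in> set Ps"
    then obtain N where N: "quasi_maximal st N" "I \<subseteq> N" "P = component N I"
      using comp by blast
    show "\<not> quasi_maximal st P"
    proof
      assume "quasi_maximal st P"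
      moreover have "P \<subseteq> N"
        using component_subset[OF N(1,2)] N(3) by simp
      ultimately have "P = N"
        using N(1) by (intro quasi_maximal_eq)
      then show False
        using component_neq_of_star_divisorial[OF fin div N(1,2)] N(3) by simp
    qed
  qed
qed

end

theorem corollary3p6:
  fixes st :: "'d::idom fract set \<Rightarrow> 'd fract set" and I :: "'d fract set"
  assumes "semistar st"
    and "star_multiplication_domain st"
    and "finite_star_character st"
    and "quasi_ideal st I"
  shows
    "(star_idempotent st I \<longleftrightarrow>
        (\<exists>Ps. (\<forall>P\<in>set Ps. quasi_prime st P \<and> star_idempotent st P) \<and> is_star_product st I Ps))
     \<and>
     ((star_idempotent st I \<and> star_divisorial st I) \<longleftrightarrow>
        (\<exists>Ps. (\<forall>P\<in>set Ps. quasi_prime st P \<and> star_idempotent st P \<and> \<not> quasi_maximal st P) \<and>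
              is_star_product st I Ps))
     \<and>
     ((star_idempotent st I \<and> star_divisorial st I) \<longleftrightarrow>
        (\<exists>Ps. (\<forall>P\<in>set Ps. quasi_prime st P \<and> star_idempotent st P \<and> star_divisorial st P) \<and>
              is_star_product st I Ps))
     \<and>
     ((star_idempotent st I \<and> star_divisorial st I) \<longleftrightarrow>
        (\<exists>!A. \<exists>Ps. mset Ps = A \<and> incomparable Ps \<and>
              (\<forall>P\<in>set Ps. quasi_prime st P \<and> star_idempotent st P \<and> star_divisorial st P) \<and>
              is_star_product st I Ps))"
    (is "(?idem \<longleftrightarrow> ?a1) \<and> (?a \<longleftrightarrow> ?b) \<and> (?a \<longleftrightarrow> ?c) \<and> (?a \<longleftrightarrow> (\<exists>!A. ?d A))")
proof -
  interpret pstar_md st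
    using assms by unfold_locales
  note fin = assms(3)
  have nzI: "nonzero_ideal I"
    using assms(4) by (simp add: quasi_ideal_def)
  have factors: "\<exists>Ps. distinct Ps \<and> is_star_product st I Ps \<and> incomparable Ps \<and>
      (\<forall>P\<in>set Ps. quasi_prime st P \<and> star_idempotent st P \<and>
        (star_divisorial st I \<longrightarrow> \<not> quasi_maximal st P))" if "?idem"
  proof -
    interpret idempotent_quasi_ideal st I
      using assms(4) that by unfold_locales
    show ?thesis
      using component_factorization[OF fin] by metis
  qed
  have bc: "?b \<longleftrightarrow> ?c"
    using star_divisorial_prime_iff[OF fin] by metis
  have ab: "?a \<longleftrightarrow> ?b"
  proof
    assume ?a
    then show ?b
      using factors by metis
  next
    assume ?b
    then show ?a
      using star_divisorial_of_product[OF fin assms(4)] by metis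
  qed
  \<comment> \<open>Incomparable factors are distinct, so each component occurs exactly once and the
    multiset of factors is determined by I.\<close>
  have unique: "mset Ps = mset_set (components I)"
    if "incomparable Ps" "\<forall>P\<in>set Ps. quasi_prime st P \<and> star_idempotent st P \<and> star_divisorial st P"
      "is_star_product st I Ps" for Ps
  proof -
    have "set Ps = components I"
      using that by (intro incomparable_factors nzI) auto
    then show ?thesis
      using mset_set_set[OF incomparable_distinct[OF that(1)]] by simp
  qed
  have "?a \<longleftrightarrow> (\<exists>!A. ?d A)"
  proof
    assume a: ?a
    then obtain Ps where Ps: "is_star_product st I Ps" "incomparable Ps"
      "\<forall>P\<in>set Ps. quasi_prime st P \<and> star_idempotent st P \<and> \<not> quasi_maximal st P"
      using factors by metis
    then have "?d (mset Ps)"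
      using star_divisorial_prime_iff[OF fin] by metis
    then show "\<exists>!A. ?d A"
    proof (rule ex1I)
      fix A
      assume "?d A"
      then obtain Qs where Qs: "mset Qs = A" "incomparable Qs" "is_star_product st I Qs"
        "\<forall>P\<in>set Qs. quasi_prime st P \<and> star_idempotent st P \<and> star_divisorial st P"
        by blast
      have "\<forall>P\<in>set Ps. quasi_prime st P \<and> star_idempotent st P \<and> star_divisorial st P"
        using Ps(3) star_divisorial_prime_iff[OF fin] by metis
      then show "A = mset Ps"
        using unique[OF Ps(2) _ Ps(1)] unique[OF Qs(2,4,3)] Qs(1) by simp
    qed
  next
    assume "\<exists>!A. ?d A"
    then have ?c
      by blast
    then show ?a
      using ab bc by simp
  qed
  moreover have "?idem \<longleftrightarrow> ?a1"
  proof
    assume ?idem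
    then show ?a1
      using factors by metis
  next
    assume ?a1
    then show ?idem
      using star_product_of_idempotents[OF nzI] by metis
  qed
  ultimately show ?thesis
    using ab bc by simp
qed

end
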